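(* Let $K$ be a field and let $\alpha_1,\dots,\alpha_n$ be elements of a field extension of $K$. Write $\boldsymbol\alpha=(\alpha_1,\dots,\alpha_n)$, $L:=K(\alpha_1,\dots,\alpha_n)$ and $L_i:=K(\alpha_j : j\neq i)$. Assume that the $\alpha_i$ form an algebraic circuit over $K$; that is, $\mathrm{trdeg}\,L_i/K=n-1$ for all $i$, and $L/L_i$ is algebraic for all $i$. Then: (1) There is a polynomial $\theta\in K[X_1,\dots,X_n]$, irreducible over $K$, with $\theta(\boldsymbol\alpha)=0$ and with top-degree given by $\deg_{X_i}\theta=[L:L_i]$ for all $i=1,\dots,n$. (2) Such a $\theta$ is unique up to multiplication with a unit in $K^\times$. (3) For all nonzero $f\in K[X_1,\dots,X_n]$ with $f(\boldsymbol\alpha)=0$, it holds that $\deg_{X_i}f\ge\deg_{X_i}\theta$ for all $i$, and $\theta$ divides $f$. (4) For all $i$, the polynomial $\theta(\alpha_1,\dots,\alpha_{i-1},X_i,\alpha_{i+1},\dots,\alpha_n)\in L_i[X_i]$ is an infimal polynomial of $\alpha_i$ over $L_i$.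
   Context: The top-degree of a polynomial in $K[X_1,\dots,X_n]$ is the collection of its degrees $\deg_{X_i}$ in the single variables $X_i$. For a field $F$ and an element $\beta$ algebraic over $F$, an infimal polynomial of $\beta$ over $F$ is any $m\in F[X]$ of degree $[F(\beta):F]$ with $m(\beta)=0$ (i.e. a nonzero scalar multiple of the minimal polynomial). *)

theory Defs
  imports
    "HOL-Library.Poly_Mapping"
    "HOL-Library.Cardinality"
    "HOL-Algebra.Generated_Fields"
    "HOL-Algebra.Algebraic_Closure_Type"
begin

text \<open>
  Multivariate polynomials with variables indexed by \<^typ>\<open>'v\<close> are finitely supported functions from
  monomials \<^typ>\<open>'v \<Rightarrow>\<^sub>0 nat\<close> to coefficients; the ring structure on \<^typ>\<open>('v \<Rightarrow>\<^sub>0 nat) \<Rightarrow>\<^sub>0 'a\<close> is the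
  convolution product of the library. For \<^typ>\<open>'n::finite\<close>, this type is
  $K[X_1,\dots,X_n]$ with $n$ the cardinality of \<^typ>\<open>'n\<close>.
\<close>

type_synonym ('v, 'a) mpoly = "('v \<Rightarrow>\<^sub>0 nat) \<Rightarrow>\<^sub>0 'a"

definition mconst :: "'a::zero \<Rightarrow> ('v, 'a) mpoly" where
  "mconst c = Poly_Mapping.single 0 c"

text \<open>Coefficients are mapped by \<open>h\<close>, and each variable \<open>v\<close> is replaced by \<open>x v\<close>.\<close>

definition mpoly_subst ::
    "('a::zero \<Rightarrow> 'b::comm_ring_1) \<Rightarrow> ('v \<Rightarrow> 'b) \<Rightarrow> ('v, 'a) mpoly \<Rightarrow> 'b" where
  "mpoly_subst h x p =
     (\<Sum>m\<in>Poly_Mapping.keys p. h (Poly_Mapping.lookup p m) *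
        (\<Prod>v\<in>Poly_Mapping.keys m. x v ^ Poly_Mapping.lookup m v))"

text \<open>The degree in the single variable \<open>i\<close>, with value 0 at the zero polynomial.\<close>

definition deg_in :: "'v \<Rightarrow> ('v, 'a::zero) mpoly \<Rightarrow> nat" where
  "deg_in i p = Max (insert 0 ((\<lambda>m. Poly_Mapping.lookup m i) ` Poly_Mapping.keys p))"

text \<open>
  Fields are types, and an extension field of \<^typ>\<open>'k\<close> is a type \<^typ>\<open>'e\<close> with a ring
  homomorphism \<open>\<iota>\<close>. Intermediate fields are subsets of \<^typ>\<open>'e\<close>, treated as subfields of the
  record \<^const>\<open>ring_of_type_algebra\<close>, so that the generated fields, dimensions and algebraic
  elements of HOL-Algebra apply.
\<close>

definition field_embedding :: "('k::field \<Rightarrow> 'e::field) \<Rightarrow> bool" where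
  "field_embedding \<iota> \<longleftrightarrow> \<iota> \<in> ring_hom ring_of_type_algebra ring_of_type_algebra"

definition adjoin :: "('k::field \<Rightarrow> 'e::field) \<Rightarrow> 'e set \<Rightarrow> 'e set" where
  "adjoin \<iota> S = generate_field ring_of_type_algebra (\<iota> ` UNIV \<union> S)"

text \<open>
  The extension \<open>E\<close> over \<open>F\<close> is finite of degree \<open>d\<close>. A relation is used because it fails for
  infinite extensions, where the function \<^const>\<open>ring.dim\<close> is unspecified.
\<close>

definition ext_degree :: "'e::field set \<Rightarrow> 'e set \<Rightarrow> nat \<Rightarrow> bool" where
  "ext_degree F E d \<longleftrightarrow> ring.dimension ring_of_type_algebra d F E"

definition algebraic_ext :: "'e::field set \<Rightarrow> 'e set \<Rightarrow> bool" where
  "algebraic_ext F E \<longleftrightarrow> (\<forall>x\<in>E. ring.algebraic ring_of_type_algebra F x)"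

text \<open>
  The variables of the polynomials are indexed by the elements of \<^typ>\<open>'e\<close> themselves; the
  variable indexed by \<open>b\<close> is evaluated at \<open>b\<close>, and only variables indexed by \<open>B\<close> may occur.
\<close>

definition alg_independent :: "('k::field \<Rightarrow> 'e::field) \<Rightarrow> 'e set \<Rightarrow> bool" where
  "alg_independent \<iota> B \<longleftrightarrow>
     (\<forall>p :: ('e, 'k) mpoly. (\<forall>m\<in>Poly_Mapping.keys p. Poly_Mapping.keys m \<subseteq> B) \<longrightarrow>
        mpoly_subst \<iota> (\<lambda>b. b) p = 0 \<longrightarrow> p = 0)"

definition transcendence_basis :: "('k::field \<Rightarrow> 'e::field) \<Rightarrow> 'e set \<Rightarrow> 'e set \<Rightarrow> bool" where
  "transcendence_basis \<iota> F B \<longleftrightarrow>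
     B \<subseteq> F \<and> alg_independent \<iota> B \<and> algebraic_ext (adjoin \<iota> B) F"

text \<open>The transcendence degree of \<open>F\<close> over \<^typ>\<open>'k\<close> is finite and equal to \<open>d\<close>.\<close>

definition has_trdeg :: "('k::field \<Rightarrow> 'e::field) \<Rightarrow> 'e set \<Rightarrow> nat \<Rightarrow> bool" where
  "has_trdeg \<iota> F d \<longleftrightarrow> (\<exists>B. transcendence_basis \<iota> F B \<and> finite B \<and> card B = d)"

definition algebraic_circuit :: "('k::field \<Rightarrow> 'e::field) \<Rightarrow> ('n::finite \<Rightarrow> 'e) \<Rightarrow> bool" where
  "algebraic_circuit \<iota> \<alpha> \<longleftrightarrow>
     (\<forall>i. has_trdeg \<iota> (adjoin \<iota> (\<alpha> ` (UNIV - {i}))) (CARD('n) - 1)) \<and>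
     (\<forall>i. algebraic_ext (adjoin \<iota> (\<alpha> ` (UNIV - {i}))) (adjoin \<iota> (\<alpha> ` UNIV)))"

definition infimal_poly :: "'e::field set \<Rightarrow> 'e \<Rightarrow> 'e poly \<Rightarrow> bool" where
  "infimal_poly F \<beta> m \<longleftrightarrow>
     (\<forall>k. Polynomial.coeff m k \<in> F) \<and> Polynomial.poly m \<beta> = 0 \<and>
     ext_degree F (generate_field ring_of_type_algebra (F \<union> {\<beta>})) (Polynomial.degree m)"

definition circuit_poly ::
    "('k::field \<Rightarrow> 'e::field) \<Rightarrow> ('n::finite \<Rightarrow> 'e) \<Rightarrow> ('n, 'k) mpoly \<Rightarrow> bool" where
  "circuit_poly \<iota> \<alpha> \<theta> \<longleftrightarrow>
     Factorial_Ring.irreducible \<theta> \<and> mpoly_subst \<iota> \<alpha> \<theta> = 0 \<and>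
     (\<forall>i. ext_degree (adjoin \<iota> (\<alpha> ` (UNIV - {i}))) (adjoin \<iota> (\<alpha> ` UNIV)) (deg_in i \<theta>))"

text \<open>$\theta(\alpha_1,\dots,\alpha_{i-1},X_i,\alpha_{i+1},\dots,\alpha_n)$, over the whole extension field.\<close>

definition subst_all_but ::
    "('k::field \<Rightarrow> 'e::field) \<Rightarrow> ('n \<Rightarrow> 'e) \<Rightarrow> 'n \<Rightarrow> ('n, 'k) mpoly \<Rightarrow> 'e poly" where
  "subst_all_but \<iota> \<alpha> i p =
     mpoly_subst (\<lambda>c. [:\<iota> c:]) (\<lambda>j. if j = i then [:0, 1:] else [:\<alpha> j:]) p"

end

theory Submission
  imports Defs
begin

text \<open>
  Write \<open>A i\<close> for the ring generated over \<open>K\<close> by the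
  \<open>\<alpha> j\<close> with \<open>j \<noteq> i\<close>, so that \<open>L i\<close> is its
  field of fractions. The hypothesis on the transcendence degree implies that these
  \<open>n - 1\<close> elements are algebraically independent (\<open>indep_on_of_trdeg\<close>, by
  the exchange property of algebraic dependence). Hence substituting them for all variables but the
  one with index \<open>i\<close> is an isomorphism \<open>\<Phi> i\<close> of $K[X_1,\dots,X_n]$
  onto \<open>(A i)[X]\<close>, which turns the degree in that variable into the degree and
  evaluation at \<open>\<alpha>\<close> into evaluation at \<open>\<alpha> i\<close>.

  Under this isomorphism everything is a statement about the ideal of the polynomials over
  \<open>A i\<close> that vanish at \<open>\<alpha> i\<close>. It is prime, it contains no nonzero
  constants, and it is nonzero because \<open>\<alpha> i\<close> is algebraic over
  \<open>L i\<close>. The ring \<open>A i\<close> is a polynomial ring over a field, hence factorial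
  (\<open>factorial_in_eval_ring\<close>). By the argument of Gauss, such an ideal contains an
  irreducible element \<open>\<theta>\<close> and is generated by any of them
  (\<open>irreducible_generates_ideal\<close>), and the image of \<open>\<theta>\<close> has the
  degree of the minimal polynomial of \<open>\<alpha> i\<close> over \<open>L i\<close>, that is,
  the degree of \<open>L\<close> over \<open>L i\<close>. Now being irreducible and vanishing at
  \<open>\<alpha>\<close> are conditions without reference to \<open>i\<close>, so the same
  \<open>\<theta>\<close> has the right degree in every variable. It divides every \<open>f\<close>
  that vanishes at \<open>\<alpha>\<close>, which bounds the degrees of \<open>f\<close>, and two
  irreducible generators differ by a unit, which is a constant.

  The rings \<open>A i\<close> are treated as subsets of the extension field, with divisibility and
  irreducibility relative to the subset. In this form factoriality can be carried along a tower of
  rings \<open>A\<close>, \<open>A[t]\<close> within one fixed type. Fractions are avoided in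
  Gauss's argument by pseudo-division and by cancelling the prime factors of constants one at a
  time.
\<close>

section \<open>Factoriality of subrings\<close>

definition subring_set :: "'a::comm_ring_1 set \<Rightarrow> bool" where
  "subring_set A \<longleftrightarrow> 1 \<in> A \<and> (\<forall>x\<in>A. \<forall>y\<in>A. x - y \<in> A \<and> x * y \<in> A)"

lemma subring_setI:
  assumes "1 \<in> A" "\<And>x y. x \<in> A \<Longrightarrow> y \<in> A \<Longrightarrow> x - y \<in> A" "\<And>x y. x \<in> A \<Longrightarrow> y \<in> A \<Longrightarrow> x * y \<in> A"
  shows "subring_set A"
  using assms by (simp add: subring_set_def)

lemma subring_set_closed:
  assumes "subring_set A"
  shows "1 \<in> A" "0 \<in> A" "x \<in> A \<Longrightarrow> y \<in> A \<Longrightarrow> x - y \<in> A" "x \<in> A \<Longrightarrow> - x \<in> A"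
    "x \<in> A \<Longrightarrow> y \<in> A \<Longrightarrow> x + y \<in> A" "x \<in> A \<Longrightarrow> y \<in> A \<Longrightarrow> x * y \<in> A" "x \<in> A \<Longrightarrow> x ^ n \<in> A"
proof -
  show 1: "1 \<in> A" using assms by (simp add: subring_set_def)
  show d: "x \<in> A \<Longrightarrow> y \<in> A \<Longrightarrow> x - y \<in> A" for x y using assms by (simp add: subring_set_def)
  show m: "x \<in> A \<Longrightarrow> y \<in> A \<Longrightarrow> x * y \<in> A" for x y using assms by (simp add: subring_set_def)
  show z: "0 \<in> A" using d[OF 1 1] by simp
  show u: "x \<in> A \<Longrightarrow> - x \<in> A" for x using d[OF z, of x] by simp
  show "x \<in> A \<Longrightarrow> y \<in> A \<Longrightarrow> x + y \<in> A" using d[OF _ u, of x y] by simp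
  show "x \<in> A \<Longrightarrow> x ^ n \<in> A" by (induction n) (auto intro: 1 m)
qed

lemma subring_set_sum:
  assumes "subring_set A" "\<And>i. i \<in> I \<Longrightarrow> f i \<in> A"
  shows "sum f I \<in> A"
  using assms(2) by (induction I rule: infinite_finite_induct) (auto intro: subring_set_closed[OF assms(1)])

text \<open>
  Arithmetic relative to a subring \<open>A\<close> of an ambient ring: only elements of
  \<open>A\<close> count as cofactors. The ring generated by some of the \<open>\<alpha> j\<close>
  is a subset of the extension field, and there all nonzero elements divide each other, so the
  relative notions are the meaningful ones.
\<close>

definition divides_in :: "'a::comm_ring_1 set \<Rightarrow> 'a \<Rightarrow> 'a \<Rightarrow> bool" where
  "divides_in A a b \<longleftrightarrow> (\<exists>c\<in>A. b = a * c)"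

definition irreducible_in :: "'a::comm_ring_1 set \<Rightarrow> 'a \<Rightarrow> bool" where
  "irreducible_in A p \<longleftrightarrow> p \<in> A \<and> p \<noteq> 0 \<and> \<not> divides_in A p 1 \<and>
     (\<forall>a\<in>A. \<forall>b\<in>A. p = a * b \<longrightarrow> divides_in A a 1 \<or> divides_in A b 1)"

text \<open>
  In a factorial domain \<open>\<rho> a\<close> can be taken to be the number of prime factors of
  \<open>a\<close>. Existence of factorizations then becomes induction on \<open>\<rho>\<close>, for which
  additivity and the fact that only units have length zero are enough; both pass to polynomial
  rings by one explicit formula.
\<close>

definition length_on :: "'a::comm_ring_1 set \<Rightarrow> ('a \<Rightarrow> nat) \<Rightarrow> bool" where
  "length_on A \<rho> \<longleftrightarrow> (\<forall>a\<in>A - {0}. (\<rho> a = 0 \<longrightarrow> divides_in A a 1) \<and>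
     (\<forall>b\<in>A - {0}. \<rho> (a * b) = \<rho> a + \<rho> b))"

definition factorial_in :: "'a::comm_ring_1 set \<Rightarrow> bool" where
  "factorial_in A \<longleftrightarrow> subring_set A \<and> (\<exists>\<rho>. length_on A \<rho>) \<and>
     (\<forall>p a b. irreducible_in A p \<longrightarrow> a \<in> A \<longrightarrow> b \<in> A \<longrightarrow> divides_in A p (a * b) \<longrightarrow>
        divides_in A p a \<or> divides_in A p b)"

lemma factorial_in_subring: "factorial_in A \<Longrightarrow> subring_set A"
  by (simp add: factorial_in_def)

lemma factorial_in_prime:
  assumes "factorial_in A" "irreducible_in A p" "a \<in> A" "b \<in> A" "divides_in A p (a * b)"
  shows "divides_in A p a \<or> divides_in A p b"
  using assms unfolding factorial_in_def by blast

text \<open>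
  Since \<open>\<rho>\<close> is additive and positive on nonunits, both factors of a proper
  factorization have smaller length. This is how the factorization of \<open>c\<close> into
  irreducibles is used below.
\<close>

lemma factorial_in_induct [consumes 3, case_names unit irreducible mult]:
  fixes A :: "'a::idom set"
  assumes A: "factorial_in A" and c: "c \<in> A" "c \<noteq> 0"
    and unit: "\<And>u. u \<in> A \<Longrightarrow> divides_in A u 1 \<Longrightarrow> P u"
    and irred: "\<And>p. irreducible_in A p \<Longrightarrow> P p"
    and mult: "\<And>a b. \<lbrakk>a \<in> A; a \<noteq> 0; b \<in> A; b \<noteq> 0; P a; P b\<rbrakk> \<Longrightarrow> P (a * b)"
  shows "P c"
proof -
  obtain \<rho> where \<rho>: "length_on A \<rho>" using A by (auto simp: factorial_in_def)
  show ?thesis using c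
  proof (induction "\<rho> c" arbitrary: c rule: less_induct)
    case less
    show ?case
    proof (cases "divides_in A c 1 \<or> irreducible_in A c")
      case True
      then show ?thesis using unit irred less.prems by blast
    next
      case False
      then obtain a b where ab: "a \<in> A" "b \<in> A" "c = a * b" "\<not> divides_in A a 1" "\<not> divides_in A b 1"
        using less.prems by (auto simp: irreducible_in_def)
      have nz: "a \<noteq> 0" "b \<noteq> 0" using ab less.prems by auto
      have "\<rho> c = \<rho> a + \<rho> b" "\<rho> a \<noteq> 0" "\<rho> b \<noteq> 0" using \<rho> ab nz by (auto simp: length_on_def)
      then show ?thesis using less.hyps[of a] less.hyps[of b] ab nz mult by auto
    qed
  qed
qed

text \<open>
  An element of \<open>P\<close> of least length is irreducible: in a factorization one factor lies
  in \<open>P\<close> and cannot be shorter, so the other factor has length zero. It is applied to a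
  prime ideal \<open>P\<close>.
\<close>

lemma irreducible_in_exists:
  assumes A: "length_on A \<rho>"
    and P: "\<And>a b. a * b \<in> P \<Longrightarrow> a \<in> A \<Longrightarrow> b \<in> A \<Longrightarrow> a \<in> P \<or> b \<in> P"
    and "1 \<notin> P" and mult: "\<And>a b. a \<in> P \<Longrightarrow> b \<in> A \<Longrightarrow> a * b \<in> P"
    and f: "f \<in> A" "f \<noteq> 0" "f \<in> P"
  shows "\<exists>p\<in>P. irreducible_in A p"
proof -
  obtain p where p: "p \<in> A \<and> p \<noteq> 0 \<and> p \<in> P"
    and min: "\<And>q. q \<in> A \<and> q \<noteq> 0 \<and> q \<in> P \<Longrightarrow> \<rho> p \<le> \<rho> q"
    using f ex_has_least_nat[of "\<lambda>p. p \<in> A \<and> p \<noteq> 0 \<and> p \<in> P" f \<rho>] by blast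
  have "irreducible_in A p" unfolding irreducible_in_def
  proof (intro conjI ballI impI)
    show "p \<in> A" "p \<noteq> 0" using p by auto
    show "\<not> divides_in A p 1" using p mult[of p] \<open>1 \<notin> P\<close> unfolding divides_in_def by metis
    fix a b assume ab: "a \<in> A" "b \<in> A" "p = a * b"
    then have nz: "a \<noteq> 0" "b \<noteq> 0" using p by auto
    have \<rho>: "\<rho> p = \<rho> a + \<rho> b" "\<rho> b = 0 \<Longrightarrow> divides_in A b 1" "\<rho> a = 0 \<Longrightarrow> divides_in A a 1"
      using A ab nz by (auto simp: length_on_def)
    then show "divides_in A a 1 \<or> divides_in A b 1"
      using P[of a b] p ab min[of a] min[of b] nz by auto
  qed
  then show ?thesis using p by blast
qed

lemma factorial_in_image:
  fixes \<phi> :: "'a::comm_ring_1 \<Rightarrow> 'b::comm_ring_1"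
  assumes A: "factorial_in A" and inj: "inj_on \<phi> A" and one: "\<phi> 1 = 1"
    and diff: "\<And>x y. \<phi> (x - y) = \<phi> x - \<phi> y" and mult: "\<And>x y. \<phi> (x * y) = \<phi> x * \<phi> y"
  shows "factorial_in (\<phi> ` A)"
proof -
  have sub: "subring_set A" by (rule factorial_in_subring[OF A])
  note [intro] = subring_set_closed[OF sub]
  have zero: "\<phi> 0 = 0" using diff[of 0 0] by simp
  have dvd: "divides_in (\<phi> ` A) (\<phi> a) (\<phi> b) \<longleftrightarrow> divides_in A a b" if "a \<in> A" "b \<in> A" for a b
    using that inj by (auto simp: divides_in_def mult[symmetric] dest!: inj_onD)
  have dvd1: "divides_in (\<phi> ` A) (\<phi> a) 1 \<longleftrightarrow> divides_in A a 1" if "a \<in> A" for a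
    using dvd[OF that, of 1] one by auto
  have eq0: "\<phi> a = 0 \<longleftrightarrow> a = 0" if "a \<in> A" for a
    using inj_onD[OF inj, of a 0] zero that by auto
  obtain \<rho> where \<rho>: "length_on A \<rho>" using A by (auto simp: factorial_in_def)
  show ?thesis unfolding factorial_in_def
  proof (intro conjI allI impI)
    show "subring_set (\<phi> ` A)"
    proof (rule subring_setI)
      show "1 \<in> \<phi> ` A" using one by (metis image_eqI subring_set_closed(1)[OF sub])
    qed (auto simp: diff[symmetric] mult[symmetric])
    have "length_on (\<phi> ` A) (\<lambda>y. \<rho> (inv_into A \<phi> y))"
      unfolding length_on_def
    proof (intro ballI conjI impI)
      fix x assume "x \<in> \<phi> ` A - {0}"
      then obtain a where a: "x = \<phi> a" "a \<in> A" "a \<noteq> 0" using zero by auto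
      show "divides_in (\<phi> ` A) x 1" if "\<rho> (inv_into A \<phi> x) = 0"
        using that a \<rho> dvd1 by (auto simp: inv_into_f_f[OF inj] length_on_def)
      fix y assume "y \<in> \<phi> ` A - {0}"
      then obtain b where b: "y = \<phi> b" "b \<in> A" "b \<noteq> 0" using zero by auto
      have "\<rho> (a * b) = \<rho> a + \<rho> b" using a b \<rho> by (auto simp: length_on_def)
      then show "\<rho> (inv_into A \<phi> (x * y)) = \<rho> (inv_into A \<phi> x) + \<rho> (inv_into A \<phi> y)"
        using a b subring_set_closed(6)[OF sub] by (simp add: mult[symmetric] inv_into_f_f[OF inj])
    qed
    then show "\<exists>\<rho>. length_on (\<phi> ` A) \<rho>" by blast
    fix p x y assume p: "irreducible_in (\<phi> ` A) p" and xy: "x \<in> \<phi> ` A" "y \<in> \<phi> ` A"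
      and d: "divides_in (\<phi> ` A) p (x * y)"
    obtain q where q: "p = \<phi> q" "q \<in> A" using p by (auto simp: irreducible_in_def)
    obtain a b where ab: "x = \<phi> a" "a \<in> A" "y = \<phi> b" "b \<in> A" using xy by auto
    have "irreducible_in A q" unfolding irreducible_in_def
    proof (intro conjI ballI impI)
      show "q \<in> A" "q \<noteq> 0" "\<not> divides_in A q 1" using p q dvd1 zero by (auto simp: irreducible_in_def)
      fix c d assume cd: "c \<in> A" "d \<in> A" "q = c * d"
      then have "p = \<phi> c * \<phi> d" using q mult by simp
      then have "divides_in (\<phi> ` A) (\<phi> c) 1 \<or> divides_in (\<phi> ` A) (\<phi> d) 1"
        using p cd unfolding irreducible_in_def by blast
      then show "divides_in A c 1 \<or> divides_in A d 1" using dvd1 cd by blast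
    qed
    moreover have "divides_in A q (a * b)" using d q ab dvd[of q "a * b"] by (auto simp: mult)
    ultimately have "divides_in A q a \<or> divides_in A q b" using factorial_in_prime[OF A] ab by blast
    then show "divides_in (\<phi> ` A) p x \<or> divides_in (\<phi> ` A) p y" using ab q dvd by auto
  qed
qed

section \<open>Polynomial rings over factorial subrings\<close>

definition polys_in :: "'a::comm_ring_1 set \<Rightarrow> 'a poly set" where
  "polys_in A = {p. \<forall>k. poly.coeff p k \<in> A}"

lemma subring_polys_in:
  assumes "subring_set A" shows "subring_set (polys_in A)"
  by (rule subring_setI) (auto simp: polys_in_def coeff_mult coeff_1 intro!: subring_set_sum[OF assms] subring_set_closed[OF assms])

lemma const_polys_in: "subring_set A \<Longrightarrow> [:a:] \<in> polys_in A \<longleftrightarrow> a \<in> A"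
  by (auto simp: polys_in_def coeff_pCons subring_set_closed split: nat.splits dest: spec[of _ 0])

lemma pCons_polys_in: "subring_set A \<Longrightarrow> pCons a p \<in> polys_in A \<longleftrightarrow> a \<in> A \<and> p \<in> polys_in A"
  by (auto simp: polys_in_def coeff_pCons split: nat.splits dest: spec[of _ 0] spec[of _ "Suc _"])

lemma smult_polys_in: "subring_set A \<Longrightarrow> a \<in> A \<Longrightarrow> p \<in> polys_in A \<Longrightarrow> Polynomial.smult a p \<in> polys_in A"
  by (auto simp: polys_in_def subring_set_closed)

lemma monom_polys_in: "subring_set A \<Longrightarrow> a \<in> A \<Longrightarrow> Polynomial.monom a n \<in> polys_in A"
  by (auto simp: polys_in_def subring_set_closed)

lemma lead_coeff_polys_in: "p \<in> polys_in A \<Longrightarrow> Polynomial.lead_coeff p \<in> A"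
  by (auto simp: polys_in_def)

lemma unit_polys_in_iff:
  fixes A :: "'a::idom set"
  assumes A: "subring_set A" and f: "f \<in> polys_in A"
  shows "divides_in (polys_in A) f 1 \<longleftrightarrow> (\<exists>a\<in>A. f = [:a:] \<and> divides_in A a 1)"
proof
  assume "divides_in (polys_in A) f 1"
  then obtain g where g: "g \<in> polys_in A" "1 = f * g" by (auto simp: divides_in_def)
  then have "f \<noteq> 0" "g \<noteq> 0" by auto
  then have "Polynomial.degree f + Polynomial.degree g = 0"
    using g(2) degree_mult_eq[of f g] by (metis Polynomial.degree_1)
  then obtain a b where ab: "f = [:a:]" "g = [:b:]" using degree_0_id by (metis add_is_0)
  then have "1 = a * b" using g(2) by (simp add: one_pCons mult.commute)
  then show "\<exists>a\<in>A. f = [:a:] \<and> divides_in A a 1"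
    using ab f g const_polys_in[OF A] by (auto simp: divides_in_def)
next
  assume "\<exists>a\<in>A. f = [:a:] \<and> divides_in A a 1"
  then obtain a b where ab: "a \<in> A" "b \<in> A" "f = [:a:]" "1 = a * b" by (auto simp: divides_in_def)
  show "divides_in (polys_in A) f 1" unfolding divides_in_def
  proof (rule bexI)
    show "1 = f * [:b:]" using ab by (simp add: one_pCons mult.commute)
    show "[:b:] \<in> polys_in A" using ab const_polys_in[OF A] by simp
  qed
qed

lemma const_divides_in_iff:
  fixes A :: "'a::idom set"
  assumes A: "subring_set A"
  shows "divides_in (polys_in A) [:c:] f \<longleftrightarrow> (\<forall>k. divides_in A c (poly.coeff f k))"
proof
  assume "divides_in (polys_in A) [:c:] f"
  then show "\<forall>k. divides_in A c (poly.coeff f k)" by (auto simp: divides_in_def polys_in_def)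
next
  assume "\<forall>k. divides_in A c (poly.coeff f k)"
  then show "divides_in (polys_in A) [:c:] f"
  proof (induction f)
    case 0
    show ?case using subring_set_closed(2)[OF subring_polys_in[OF A]] by (auto simp: divides_in_def)
  next
    case (pCons a f)
    have "divides_in A c (poly.coeff f k)" for k using pCons.prems[rule_format, of "Suc k"] by simp
    then obtain g where g: "g \<in> polys_in A" "f = [:c:] * g" using pCons.IH by (auto simp: divides_in_def)
    obtain b where b: "b \<in> A" "a = c * b" using pCons.prems[rule_format, of 0] by (auto simp: divides_in_def)
    show ?case unfolding divides_in_def
      by (rule bexI[of _ "pCons b g"]) (use g b pCons_polys_in[OF A] in auto)
  qed
qed

lemma divides_in_sum:
  assumes "subring_set A" "\<And>i. i \<in> I \<Longrightarrow> divides_in A p (f i)"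
  shows "divides_in A p (sum f I)"
proof -
  obtain g where g: "\<And>i. i \<in> I \<Longrightarrow> g i \<in> A \<and> f i = p * g i"
    using assms(2) unfolding divides_in_def by metis
  then have "sum f I = p * sum g I" by (simp add: sum_distrib_left)
  then show ?thesis unfolding divides_in_def using subring_set_sum[OF assms(1), of I g] g by blast
qed

text \<open>
  Gauss's lemma. If \<open>p\<close> divides neither factor, take the first coefficients
  \<open>f\<^sub>i\<close> and \<open>g\<^sub>j\<close> that it does not divide. All terms but
  \<open>f\<^sub>i g\<^sub>j\<close> of the coefficient of index \<open>i + j\<close> of the product
  are then divisible by \<open>p\<close>.
\<close>

lemma const_prime_polys_in:
  fixes A :: "'a::idom set"
  assumes A: "factorial_in A" and p: "irreducible_in A p" and fg: "f \<in> polys_in A" "g \<in> polys_in A"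
    and d: "divides_in (polys_in A) [:p:] (f * g)"
  shows "divides_in (polys_in A) [:p:] f \<or> divides_in (polys_in A) [:p:] g"
proof (rule ccontr)
  have sub: "subring_set A" by (rule factorial_in_subring[OF A])
  assume "\<not> ?thesis"
  then have ex: "\<exists>i. \<not> divides_in A p (poly.coeff f i)" "\<exists>j. \<not> divides_in A p (poly.coeff g j)"
    using const_divides_in_iff[OF sub] by auto
  define i where "i = (LEAST i. \<not> divides_in A p (poly.coeff f i))"
  define j where "j = (LEAST j. \<not> divides_in A p (poly.coeff g j))"
  have i: "\<not> divides_in A p (poly.coeff f i)" "\<And>k. k < i \<Longrightarrow> divides_in A p (poly.coeff f k)"
    unfolding i_def using LeastI_ex[OF ex(1)] by (assumption, blast dest: not_less_Least)
  have j: "\<not> divides_in A p (poly.coeff g j)" "\<And>k. k < j \<Longrightarrow> divides_in A p (poly.coeff g k)"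
    unfolding j_def using LeastI_ex[OF ex(2)] by (assumption, blast dest: not_less_Least)
  have coeffs: "poly.coeff f k \<in> A" "poly.coeff g k \<in> A" for k using fg by (auto simp: polys_in_def)
  have rest: "divides_in A p (\<Sum>k\<in>{..i+j} - {i}. poly.coeff f k * poly.coeff g (i + j - k))"
  proof (rule divides_in_sum[OF sub])
    fix k assume k: "k \<in> {..i+j} - {i}"
    show "divides_in A p (poly.coeff f k * poly.coeff g (i + j - k))"
    proof (cases "k < i")
      case True
      then obtain c where "c \<in> A" "poly.coeff f k = p * c" using i(2) by (auto simp: divides_in_def)
      then show ?thesis unfolding divides_in_def
        by (intro bexI[of _ "c * poly.coeff g (i + j - k)"]) (auto intro: subring_set_closed[OF sub] coeffs)
    next
      case False
      then have "i + j - k < j" using k by auto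
      then obtain c where "c \<in> A" "poly.coeff g (i + j - k) = p * c" using j(2) by (auto simp: divides_in_def)
      then show ?thesis unfolding divides_in_def
        by (intro bexI[of _ "c * poly.coeff f k"]) (auto intro: subring_set_closed[OF sub] coeffs)
    qed
  qed
  have "poly.coeff (f * g) (i + j) = poly.coeff f i * poly.coeff g j +
      (\<Sum>k\<in>{..i+j} - {i}. poly.coeff f k * poly.coeff g (i + j - k))"
    unfolding coeff_mult by (subst sum.remove[of _ i]) auto
  moreover have "divides_in A p (poly.coeff (f * g) (i + j))" using d const_divides_in_iff[OF sub] by blast
  ultimately have "divides_in A p (poly.coeff f i * poly.coeff g j)"
    using rest unfolding divides_in_def
    by (metis add_diff_cancel_right' right_diff_distrib subring_set_closed(3)[OF sub])
  then show False using factorial_in_prime[OF A p] i(1) j(1) coeffs by blast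
qed

text \<open>
  Division with remainder after multiplication by a nonzero constant of \<open>A\<close>, which
  takes the place of passing to the field of fractions of \<open>A\<close>.
\<close>

lemma pseudo_division_in:
  fixes A :: "'a::idom set"
  assumes A: "subring_set A" and f: "f \<in> polys_in A" and g: "g \<in> polys_in A" "g \<noteq> 0"
  shows "\<exists>c q r. c \<in> A \<and> c \<noteq> 0 \<and> q \<in> polys_in A \<and> r \<in> polys_in A \<and>
    Polynomial.smult c f = g * q + r \<and> (r = 0 \<or> Polynomial.degree r < Polynomial.degree g)"
  using f
proof (induction "Polynomial.degree f" arbitrary: f rule: less_induct)
  case less
  note cl = subring_set_closed[OF subring_polys_in[OF A]] smult_polys_in[OF A] monom_polys_in[OF A]
  let ?b = "Polynomial.lead_coeff g"
  have b: "?b \<in> A" "?b \<noteq> 0" using g lead_coeff_polys_in by auto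
  show ?case
  proof (cases "f = 0 \<or> Polynomial.degree f < Polynomial.degree g")
    case True
    have "Polynomial.smult 1 f = g * 0 + f" by simp
    then show ?thesis using True less.prems cl(2) subring_set_closed(1)[OF A]
      by (intro exI[of _ 1] exI[of _ 0] exI[of _ f]) auto
  next
    case False
    define m where "m = Polynomial.monom (Polynomial.lead_coeff f) (Polynomial.degree f - Polynomial.degree g)"
    \<comment> \<open>subtracting this multiple of \<open>g\<close> removes the leading term of \<open>f\<close>\<close>
    define f' where "f' = Polynomial.smult ?b f - m * g"
    have m: "m \<in> polys_in A" using less.prems by (auto simp: m_def intro!: cl lead_coeff_polys_in)
    have f': "f' \<in> polys_in A" unfolding f'_def using less.prems m g b by (intro cl) auto
    have mg: "m \<noteq> 0" "Polynomial.degree (m * g) = Polynomial.degree f"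
      using False g by (auto simp: m_def degree_mult_eq degree_monom_eq monom_eq_0_iff)
    have "Polynomial.degree f' \<le> Polynomial.degree f"
      unfolding f'_def using mg by (intro Polynomial.degree_diff_le) auto
    moreover have "poly.coeff f' (Polynomial.degree f) = 0"
      using False by (auto simp: f'_def m_def coeff_monom_mult)
    ultimately have deg: "Polynomial.degree f' < Polynomial.degree f" if "f' \<noteq> 0"
      using that by (metis le_neq_implies_less leading_coeff_0_iff)
    show ?thesis
    proof (cases "f' = 0")
      case True
      then have "Polynomial.smult ?b f = g * m + 0" by (simp add: f'_def)
      then show ?thesis using b m cl(2) by blast
    next
      case False
      then obtain c q r where IH: "c \<in> A" "c \<noteq> 0" "q \<in> polys_in A" "r \<in> polys_in A"
        "Polynomial.smult c f' = g * q + r" "r = 0 \<or> Polynomial.degree r < Polynomial.degree g"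
        using less.hyps[OF deg f'] by blast
      have "Polynomial.smult (c * ?b) f = Polynomial.smult c f' + Polynomial.smult c (m * g)"
        by (simp add: f'_def smult_diff_right)
      also have "\<dots> = g * (q + Polynomial.smult c m) + r" by (simp add: IH(5) algebra_simps)
      finally show ?thesis
        using IH b m by (intro exI[of _ "c * ?b"] exI[of _ "q + Polynomial.smult c m"] exI[of _ r])
          (auto intro!: cl subring_set_closed[OF A])
    qed
  qed
qed

lemma const_irreducible_divides_in_cancel:
  fixes A :: "'a::idom set"
  assumes A: "factorial_in A" and p: "irreducible_in A p" and fg: "f \<in> polys_in A" "g \<in> polys_in A"
    and eq: "Polynomial.smult p h = f * g" and h: "h \<in> polys_in A"
  shows "(\<exists>f'\<in>polys_in A. f = Polynomial.smult p f' \<and> h = f' * g) \<or>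
    (\<exists>g'\<in>polys_in A. g = Polynomial.smult p g' \<and> h = f * g')"
proof -
  have p0: "p \<noteq> 0" using p by (simp add: irreducible_in_def)
  have "divides_in (polys_in A) [:p:] (f * g)" using eq h by (auto simp: divides_in_def intro!: bexI[of _ h])
  from const_prime_polys_in[OF A p fg this] show ?thesis
  proof
    assume "divides_in (polys_in A) [:p:] f"
    then obtain f' where f': "f' \<in> polys_in A" "f = Polynomial.smult p f'" by (auto simp: divides_in_def)
    have "Polynomial.smult p (h - f' * g) = 0" using eq f' by (simp add: smult_diff_right)
    then have "h = f' * g" using p0 by simp
    then show ?thesis using f' by blast
  next
    assume "divides_in (polys_in A) [:p:] g"
    then obtain g' where g': "g' \<in> polys_in A" "g = Polynomial.smult p g'" by (auto simp: divides_in_def)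
    have "Polynomial.smult p (h - f * g') = 0" using eq g' by (simp add: smult_diff_right)
    then have "h = f * g'" using p0 by simp
    then show ?thesis using g' by blast
  qed
qed

text \<open>
  A factorization of \<open>c \<theta>\<close> comes from one of \<open>\<theta>\<close>: each prime
  factor of the constant \<open>c\<close> is prime in \<open>A[X]\<close>, so it can be cancelled
  from \<open>q\<close> or from \<open>h\<close>. Only the constant \<open>d\<close> that
  \<open>h\<close> loses is recorded, because the use is for an irreducible \<open>\<theta>\<close>,
  where one of the two factors is a unit.
\<close>

lemma clear_const_factorization:
  fixes A :: "'a::idom set"
  assumes A: "factorial_in A" and c: "c \<in> A" "c \<noteq> 0"
  shows "\<lbrakk>\<theta> \<in> polys_in A; q \<in> polys_in A; h \<in> polys_in A; Polynomial.smult c \<theta> = q * h\<rbrakk> \<Longrightarrow>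
    \<exists>q'\<in>polys_in A. \<exists>h'\<in>polys_in A. \<exists>d\<in>A. \<theta> = q' * h' \<and> h = Polynomial.smult d h'"
  using A c
proof (induction arbitrary: \<theta> q h rule: factorial_in_induct)
  case (unit u)
  then obtain v where v: "v \<in> A" "1 = u * v" by (auto simp: divides_in_def)
  have "\<theta> = Polynomial.smult (v * u) \<theta>" using v by (simp add: mult.commute)
  also have "\<dots> = Polynomial.smult v q * h" using unit(6) by (metis mult_smult_left smult_smult)
  finally show ?case using unit v smult_polys_in[OF factorial_in_subring[OF A], of v q] subring_set_closed(1)[OF factorial_in_subring[OF A]]
    by (intro bexI[of _ "Polynomial.smult v q"] bexI[of _ h] bexI[of _ 1]) auto
next
  case (irreducible p)
  from const_irreducible_divides_in_cancel[OF A irreducible(1,3,4,5,2)] show ?case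
  proof
    assume "\<exists>f'\<in>polys_in A. q = Polynomial.smult p f' \<and> \<theta> = f' * h"
    then obtain f' where "f' \<in> polys_in A" "\<theta> = f' * h" by blast
    then show ?thesis using irreducible subring_set_closed(1)[OF factorial_in_subring[OF A]]
      by (intro bexI[of _ f'] bexI[of _ h] bexI[of _ 1]) auto
  next
    assume "\<exists>g'\<in>polys_in A. h = Polynomial.smult p g' \<and> \<theta> = q * g'"
    then show ?thesis using irreducible(1,3) unfolding irreducible_in_def by blast
  qed
next
  case (mult a b)
  have "Polynomial.smult b \<theta> \<in> polys_in A" using mult smult_polys_in[OF factorial_in_subring[OF A]] by blast
  then obtain q1 h1 d1 where 1: "q1 \<in> polys_in A" "h1 \<in> polys_in A" "d1 \<in> A"
    "Polynomial.smult b \<theta> = q1 * h1" "h = Polynomial.smult d1 h1"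
    using mult.IH(1)[of "Polynomial.smult b \<theta>" q h] mult.prems by auto
  then obtain q2 h2 d2 where 2: "q2 \<in> polys_in A" "h2 \<in> polys_in A" "d2 \<in> A"
    "\<theta> = q2 * h2" "h1 = Polynomial.smult d2 h2"
    using mult.IH(2)[of \<theta> q1 h1] mult.prems by blast
  then show ?case using 1 subring_set_closed(6)[OF factorial_in_subring[OF A], of d1 d2]
    by (intro bexI[of _ q2] bexI[of _ h2] bexI[of _ "d1 * d2"]) auto
qed

text \<open>
  A prime factor of \<open>c\<close> that divides \<open>\<theta> w\<close> must divide
  \<open>w\<close>: it cannot divide \<open>\<theta>\<close>, since the irreducible
  \<open>\<theta>\<close> would then be that constant up to a unit and have degree zero.
\<close>

lemma divides_in_cancel_const:
  fixes A :: "'a::idom set"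
  assumes A: "factorial_in A" and \<theta>: "irreducible_in (polys_in A) \<theta>" "Polynomial.degree \<theta> > 0"
    and c: "c \<in> A" "c \<noteq> 0"
  shows "\<lbrakk>g \<in> polys_in A; divides_in (polys_in A) \<theta> (Polynomial.smult c g)\<rbrakk> \<Longrightarrow> divides_in (polys_in A) \<theta> g"
  using A c
proof (induction arbitrary: g rule: factorial_in_induct)
  case (unit u)
  then obtain v w where v: "v \<in> A" "1 = u * v" "w \<in> polys_in A" "Polynomial.smult u g = \<theta> * w"
    by (auto simp: divides_in_def)
  have "g = Polynomial.smult (v * u) g" using v by (simp add: mult.commute)
  also have "\<dots> = \<theta> * Polynomial.smult v w" using v(4) by (metis mult_smult_right smult_smult)
  finally show ?case using v smult_polys_in[OF factorial_in_subring[OF A], of v w] unfolding divides_in_def by blast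
next
  case (irreducible p)
  then obtain w where w: "w \<in> polys_in A" "Polynomial.smult p g = \<theta> * w"
    by (auto simp: divides_in_def)
  have \<theta>A: "\<theta> \<in> polys_in A" using \<theta> by (simp add: irreducible_in_def)
  have p: "p \<in> A" "\<not> divides_in A p 1" using irreducible by (auto simp: irreducible_in_def)
  have no: "\<theta> \<noteq> Polynomial.smult p t" if t: "t \<in> polys_in A" for t
  proof
    assume eq: "\<theta> = Polynomial.smult p t"
    have "\<theta> = [:p:] * t" using eq by simp
    moreover have "[:p:] \<in> polys_in A" using p const_polys_in[OF factorial_in_subring[OF A]] by simp
    moreover have "\<not> divides_in (polys_in A) [:p:] 1"
      using p unit_polys_in_iff[OF factorial_in_subring[OF A]] const_polys_in[OF factorial_in_subring[OF A]] by auto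
    ultimately have "divides_in (polys_in A) t 1" using \<theta>(1) t unfolding irreducible_in_def by blast
    then have "Polynomial.degree t = 0" using unit_polys_in_iff[OF factorial_in_subring[OF A] t] by auto
    then show False using eq \<theta>(2) by (metis degree_smult_le le_zero_eq not_less_zero)
  qed
  from const_irreducible_divides_in_cancel[OF A irreducible(1) \<theta>A w irreducible(2)] show ?case
    using no by (auto simp: divides_in_def)
next
  case (mult a b)
  then show ?case using smult_polys_in[OF factorial_in_subring[OF A], of b g] by auto
qed

text \<open>
  Over the field of fractions of \<open>A\<close> the ideal \<open>I\<close> is generated by an element
  \<open>h\<close> of least degree; hence every element of \<open>I\<close> is a multiple of
  \<open>h\<close> after multiplication by a constant. For \<open>\<theta>\<close> this gives
  \<open>c \<theta> = q h\<close>. Since \<open>\<theta>\<close> is irreducible and \<open>I\<close>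
  contains no nonzero constant, \<open>h\<close> must be a constant multiple of
  \<open>\<theta>\<close>. So \<open>\<theta>\<close> divides a constant multiple of each
  \<open>f\<close> in \<open>I\<close>, and the constant can be cancelled.

  The lemma is used twice: to show that \<open>A[X]\<close> is again factorial, and for the ideal of
  the polynomials that vanish at \<open>\<alpha> i\<close>.
\<close>

lemma irreducible_generates_ideal:
  fixes A :: "'a::idom set"
  assumes A: "factorial_in A" and I: "I \<subseteq> polys_in A"
    and diff: "\<And>f g. f \<in> I \<Longrightarrow> g \<in> I \<Longrightarrow> f - g \<in> I"
    and mult: "\<And>f g. f \<in> I \<Longrightarrow> g \<in> polys_in A \<Longrightarrow> f * g \<in> I"
    and triv: "\<And>a. [:a:] \<in> I \<Longrightarrow> a = 0"
    and \<theta>: "irreducible_in (polys_in A) \<theta>" "\<theta> \<in> I" and f: "f \<in> I"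
  shows "divides_in (polys_in A) \<theta> f"
proof -
  have sub: "subring_set A" by (rule factorial_in_subring[OF A])
  note cl = subring_set_closed[OF subring_polys_in[OF sub]]
  have \<theta>0: "\<theta> \<noteq> 0" using \<theta> by (simp add: irreducible_in_def)
  have deg\<theta>: "Polynomial.degree \<theta> > 0"
  proof (rule ccontr)
    assume "\<not> ?thesis"
    then obtain a where "\<theta> = [:a:]" using degree_0_id[of \<theta>] by (metis neq0_conv)
    then show False using triv[of a] \<theta> \<theta>0 by auto
  qed
  obtain h where h: "h \<in> I" "h \<noteq> 0"
    and min: "\<And>g. g \<in> I \<Longrightarrow> g \<noteq> 0 \<Longrightarrow> Polynomial.degree h \<le> Polynomial.degree g"
    using ex_has_least_nat[of "\<lambda>g. g \<in> I \<and> g \<noteq> 0" \<theta> Polynomial.degree] \<theta>(2) \<theta>0 by blast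
  have mult_h: "\<exists>c q. c \<in> A \<and> c \<noteq> 0 \<and> q \<in> polys_in A \<and> Polynomial.smult c g = q * h" if g: "g \<in> I" for g
  proof -
    obtain c q r where cqr: "c \<in> A" "c \<noteq> 0" "q \<in> polys_in A" "r \<in> polys_in A"
      "Polynomial.smult c g = h * q + r" "r = 0 \<or> Polynomial.degree r < Polynomial.degree h"
      using pseudo_division_in[OF sub, of g h] g h I by blast
    have "r = g * [:c:] - h * q" using cqr(5) by simp
    also have "\<dots> \<in> I" using g h cqr const_polys_in[OF sub, of c] by (intro diff mult) auto
    finally have "r \<in> I" .
    then have "r = 0" using min[of r] cqr(6) by (metis leD)
    then have "Polynomial.smult c g = q * h" using cqr(5) by (simp add: mult.commute)
    then show ?thesis using cqr(1-3) by blast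
  qed
  obtain c q where cq: "c \<in> A" "c \<noteq> 0" "q \<in> polys_in A" "Polynomial.smult c \<theta> = q * h"
    using mult_h[OF \<theta>(2)] by blast
  have \<theta>A: "\<theta> \<in> polys_in A" and hA: "h \<in> polys_in A" and fA: "f \<in> polys_in A" using \<theta> h f I by auto
  obtain q' h' d where qh: "q' \<in> polys_in A" "h' \<in> polys_in A" "d \<in> A" "\<theta> = q' * h'" "h = Polynomial.smult d h'"
    using clear_const_factorization[OF A cq(1,2) \<theta>A cq(3) hA cq(4)] by blast
  \<comment> \<open>otherwise \<open>h\<close> would be a nonzero constant in \<open>I\<close>\<close>
  have "\<not> divides_in (polys_in A) h' 1"
  proof
    assume "divides_in (polys_in A) h' 1"
    then obtain a where "h' = [:a:]" using unit_polys_in_iff[OF sub qh(2)] by auto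
    then show False using triv[of "d * a"] qh(5) h by auto
  qed
  then have "divides_in (polys_in A) q' 1" using \<theta>(1) qh unfolding irreducible_in_def by blast
  then obtain u where u: "u \<in> polys_in A" "1 = q' * u" by (auto simp: divides_in_def)
  have "h = \<theta> * (u * [:d:])"
  proof -
    have "\<theta> * (u * [:d:]) = (q' * u) * (h' * [:d:])" by (simp add: qh(4) algebra_simps)
    then show ?thesis using u(2) qh(5) by simp
  qed
  moreover obtain c2 q2 where 2: "c2 \<in> A" "c2 \<noteq> 0" "q2 \<in> polys_in A" "Polynomial.smult c2 f = q2 * h"
    using mult_h[OF f] by blast
  ultimately have "Polynomial.smult c2 f = \<theta> * (u * [:d:] * q2)" by (simp add: algebra_simps)
  moreover have "u * [:d:] * q2 \<in> polys_in A" using u qh 2 const_polys_in[OF sub, of d] by (intro cl) auto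
  ultimately have "divides_in (polys_in A) \<theta> (Polynomial.smult c2 f)"
    unfolding divides_in_def by blast
  then show ?thesis using divides_in_cancel_const[OF A \<theta>(1) deg\<theta> 2(1,2) fA] by blast
qed

lemma length_on_polys_in:
  fixes A :: "'a::idom set"
  assumes sub: "subring_set A" and \<rho>: "length_on A \<rho>"
  shows "length_on (polys_in A) (\<lambda>f. Polynomial.degree f + \<rho> (Polynomial.lead_coeff f))"
  unfolding length_on_def
proof (intro ballI conjI impI)
  fix f assume f: "f \<in> polys_in A - {0}"
  then have lf: "Polynomial.lead_coeff f \<in> A - {0}" using lead_coeff_polys_in by auto
  show "divides_in (polys_in A) f 1" if z: "Polynomial.degree f + \<rho> (Polynomial.lead_coeff f) = 0"
  proof -
    obtain a where a: "f = [:a:]" using z degree_0_id[of f] by (metis add_is_0)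
    then show ?thesis using z lf \<rho> f by (auto simp: unit_polys_in_iff[OF sub] length_on_def)
  qed
  fix g assume g: "g \<in> polys_in A - {0}"
  then have "Polynomial.lead_coeff g \<in> A - {0}" using lead_coeff_polys_in by auto
  then have "\<rho> (Polynomial.lead_coeff f * Polynomial.lead_coeff g) = \<rho> (Polynomial.lead_coeff f) + \<rho> (Polynomial.lead_coeff g)"
    using \<rho> lf unfolding length_on_def by blast
  then show "Polynomial.degree (f * g) + \<rho> (Polynomial.lead_coeff (f * g)) =
    Polynomial.degree f + \<rho> (Polynomial.lead_coeff f) + (Polynomial.degree g + \<rho> (Polynomial.lead_coeff g))"
    using f g Polynomial.lead_coeff_mult[of f g] by (simp add: degree_mult_eq)
qed

text \<open>
  For an irreducible \<open>\<theta>\<close> of positive degree with \<open>\<theta> | f g\<close>,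
  consider the ideal \<open>I\<close> generated by \<open>\<theta>\<close> and \<open>f\<close>. If
  \<open>I\<close> contains a constant \<open>a \<noteq> 0\<close>, then \<open>\<theta>\<close>
  divides \<open>a g\<close>, hence \<open>g\<close>. Otherwise \<open>\<theta>\<close> generates
  \<open>I\<close> and divides \<open>f\<close>.
\<close>

theorem factorial_in_polys_in:
  fixes A :: "'a::idom set"
  assumes A: "factorial_in A"
  shows "factorial_in (polys_in A)"
  unfolding factorial_in_def
proof (intro conjI allI impI)
  show sub: "subring_set (polys_in A)" using A subring_polys_in by (auto simp: factorial_in_def)
  have subA: "subring_set A" by (rule factorial_in_subring[OF A])
  note cl = subring_set_closed[OF sub]
  show "\<exists>\<rho>. length_on (polys_in A) \<rho>" using A length_on_polys_in by (auto simp: factorial_in_def)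
  fix \<theta> f g
  assume \<theta>: "irreducible_in (polys_in A) \<theta>" and f: "f \<in> polys_in A" and g: "g \<in> polys_in A"
    and d: "divides_in (polys_in A) \<theta> (f * g)"
  have \<theta>A: "\<theta> \<in> polys_in A" using \<theta> by (simp add: irreducible_in_def)
  show "divides_in (polys_in A) \<theta> f \<or> divides_in (polys_in A) \<theta> g"
  proof (cases "Polynomial.degree \<theta> = 0")
    case True
    then obtain p where p: "\<theta> = [:p:]" by (metis degree_0_id)
    have "irreducible_in A p" unfolding irreducible_in_def
    proof (intro conjI ballI impI)
      show pA: "p \<in> A" using \<theta>A p const_polys_in[OF subA] by simp
      show "p \<noteq> 0" "\<not> divides_in A p 1"
        using \<theta> p unit_polys_in_iff[OF subA \<theta>A] pA by (auto simp: irreducible_in_def)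
      fix a b assume ab: "a \<in> A" "b \<in> A" "p = a * b"
      have mem: "[:a:] \<in> polys_in A" "[:b:] \<in> polys_in A" using ab const_polys_in[OF subA] by auto
      have "\<theta> = [:a:] * [:b:]" using ab p by simp
      then have "divides_in (polys_in A) [:a:] 1 \<or> divides_in (polys_in A) [:b:] 1"
        using \<theta> mem unfolding irreducible_in_def by blast
      then show "divides_in A a 1 \<or> divides_in A b 1" using unit_polys_in_iff[OF subA] mem by auto
    qed
    then show ?thesis using const_prime_polys_in[OF A _ f g] d p by simp
  next
    case False
    define I where "I = {u * \<theta> + v * f |u v. u \<in> polys_in A \<and> v \<in> polys_in A}"
    have I: "I \<subseteq> polys_in A" using \<theta>A f by (auto simp: I_def intro!: cl)
    show ?thesis
    proof (cases "\<exists>a. a \<noteq> 0 \<and> [:a:] \<in> I")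
      case True
      then obtain a u v where a: "a \<noteq> 0" "[:a:] \<in> I" and uv: "u \<in> polys_in A" "v \<in> polys_in A" "[:a:] = u * \<theta> + v * f"
        unfolding I_def by blast
      have aA: "a \<in> A" using a I const_polys_in[OF subA] by auto
      obtain w where w: "w \<in> polys_in A" "f * g = \<theta> * w" using d by (auto simp: divides_in_def)
      have "Polynomial.smult a g = (u * \<theta> + v * f) * g" using uv(3) by (metis mult_pCons_left mult_zero_left pCons_0_0 add.right_neutral)
      also have "\<dots> = u * \<theta> * g + v * (f * g)" by (simp add: algebra_simps)
      also have "\<dots> = \<theta> * (u * g + v * w)" unfolding w by (simp add: algebra_simps)
      finally have "divides_in (polys_in A) \<theta> (Polynomial.smult a g)"
        using uv w g by (auto simp: divides_in_def intro!: bexI[of _ "u * g + v * w"] cl)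
      then show ?thesis using divides_in_cancel_const[OF A \<theta> _ aA a(1) g] False by blast
    next
      case triv: False
      have "divides_in (polys_in A) \<theta> f"
      proof (rule irreducible_generates_ideal[OF A I])
        show "x - y \<in> I" if "x \<in> I" "y \<in> I" for x y
        proof -
          obtain u v u' v' where uv: "u \<in> polys_in A" "v \<in> polys_in A" "u' \<in> polys_in A" "v' \<in> polys_in A"
            "x = u * \<theta> + v * f" "y = u' * \<theta> + v' * f" using \<open>x \<in> I\<close> \<open>y \<in> I\<close> by (auto simp: I_def)
          have "x - y = (u - u') * \<theta> + (v - v') * f" by (simp add: uv algebra_simps)
          then show ?thesis using uv cl(3) unfolding I_def by blast
        qed
        show "x * y \<in> I" if "x \<in> I" "y \<in> polys_in A" for x y
        proof -
          obtain u v where uv: "u \<in> polys_in A" "v \<in> polys_in A" "x = u * \<theta> + v * f"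
            using \<open>x \<in> I\<close> by (auto simp: I_def)
          have "x * y = (u * y) * \<theta> + (v * y) * f" by (simp add: uv algebra_simps)
          then show ?thesis using uv that cl(6) unfolding I_def by blast
        qed
        show "a = 0" if "[:a:] \<in> I" for a using triv that by blast
        have "\<theta> = 1 * \<theta> + 0 * f" "f = 0 * \<theta> + 1 * f" by auto
        then show "\<theta> \<in> I" "f \<in> I" using cl(1,2) unfolding I_def by blast+
      qed (rule \<theta>)
      then show ?thesis ..
    qed
  qed
qed

section \<open>Evaluation of multivariate polynomials\<close>

locale unital_hom =
  fixes h :: "'a::comm_ring_1 \<Rightarrow> 'b::comm_ring_1"
  assumes hom_one: "h 1 = 1" and hom_add: "h (a + b) = h a + h b" and hom_mult: "h (a * b) = h a * h b"
begin

lemma hom_zero: "h 0 = 0"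
  using hom_add[of 0 0] by simp

lemma hom_diff: "h (a - b) = h a - h b"
  using hom_add[of "a - b" b] by (simp add: algebra_simps)

lemma hom_sum: "h (sum f I) = (\<Sum>i\<in>I. h (f i))"
  by (induction I rule: infinite_finite_induct) (simp_all add: hom_zero hom_add)

lemma hom_prod: "h (prod f I) = (\<Prod>i\<in>I. h (f i))"
  by (induction I rule: infinite_finite_induct) (simp_all add: hom_one hom_mult)

lemma hom_power: "h (a ^ n) = h a ^ n"
  by (induction n) (simp_all add: hom_one hom_mult)

lemma subring_image: "subring_set A \<Longrightarrow> subring_set (h ` A)"
proof (rule subring_setI)
  assume A: "subring_set A"
  show "1 \<in> h ` A" using hom_one subring_set_closed(1)[OF A] by (metis imageI)
  show "x - y \<in> h ` A" "x * y \<in> h ` A" if xy: "x \<in> h ` A" "y \<in> h ` A" for x y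
    using xy by (auto simp: hom_diff[symmetric] hom_mult[symmetric] intro!: imageI subring_set_closed[OF A])
qed

end

lemma unital_hom_const_poly: "unital_hom (\<lambda>c::'a::comm_ring_1. [:c:])"
  by unfold_locales (simp_all add: one_pCons)

lemma unital_hom_poly: "unital_hom (\<lambda>p. poly p (a::'a::comm_ring_1))"
  by unfold_locales simp_all

lemma unital_hom_comp: "unital_hom g \<Longrightarrow> unital_hom h \<Longrightarrow> unital_hom (\<lambda>c. g (h c))"
  by (simp add: unital_hom_def)

definition monom_eval :: "('v \<Rightarrow> 'b::comm_ring_1) \<Rightarrow> ('v \<Rightarrow>\<^sub>0 nat) \<Rightarrow> 'b" where
  "monom_eval x m = (\<Prod>v\<in>Poly_Mapping.keys m. x v ^ Poly_Mapping.lookup m v)"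

lemma monom_eval_superset:
  assumes "finite S" "Poly_Mapping.keys m \<subseteq> S"
  shows "monom_eval x m = (\<Prod>v\<in>S. x v ^ Poly_Mapping.lookup m v)"
  unfolding monom_eval_def using assms
  by (intro prod.mono_neutral_left) (auto simp: not_in_keys_iff_lookup_eq_zero)

lemma monom_eval_add: "monom_eval x (m + n) = monom_eval x m * monom_eval x n"
proof -
  let ?S = "Poly_Mapping.keys m \<union> Poly_Mapping.keys n"
  have "monom_eval x (m + n) = (\<Prod>v\<in>?S. x v ^ Poly_Mapping.lookup (m + n) v)"
    using Poly_Mapping.keys_add[of m n] by (intro monom_eval_superset) auto
  also have "\<dots> = (\<Prod>v\<in>?S. x v ^ Poly_Mapping.lookup m v) * (\<Prod>v\<in>?S. x v ^ Poly_Mapping.lookup n v)"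
    by (simp add: lookup_add power_add prod.distrib)
  also have "\<dots> = monom_eval x m * monom_eval x n"
    by (simp add: monom_eval_superset[of ?S])
  finally show ?thesis .
qed

lemma monom_eval_single: "monom_eval x (Poly_Mapping.single v k) = x v ^ k"
  by (simp add: monom_eval_def)

lemma monom_eval_cong: "(\<And>v. v \<in> Poly_Mapping.keys m \<Longrightarrow> x v = y v) \<Longrightarrow> monom_eval x m = monom_eval y m"
  by (simp add: monom_eval_def)

lemma mpoly_subst_alt:
  "mpoly_subst h x p = (\<Sum>m\<in>Poly_Mapping.keys p. h (Poly_Mapping.lookup p m) * monom_eval x m)"
  by (simp add: mpoly_subst_def monom_eval_def)

text \<open>
  Applied to polynomials this is the decomposition into terms, and applied to exponent vectors it
  recovers a monomial from its powers of single variables.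
\<close>

lemma sum_singles: "(\<Sum>m\<in>Poly_Mapping.keys p. Poly_Mapping.single m (Poly_Mapping.lookup p m)) = p"
proof (rule poly_mapping_eqI)
  fix k
  show "Poly_Mapping.lookup (\<Sum>m\<in>Poly_Mapping.keys p. Poly_Mapping.single m (Poly_Mapping.lookup p m)) k =
      Poly_Mapping.lookup p k"
    by (simp add: lookup_sum lookup_single when_def in_keys_iff)
qed

definition mvar :: "'v \<Rightarrow> ('v, 'a::comm_ring_1) mpoly" where
  "mvar v = Poly_Mapping.single (Poly_Mapping.single v 1) 1"

lemma mvar_power: "mvar v ^ k = Poly_Mapping.single (Poly_Mapping.single v k) 1"
  by (induction k) (simp_all add: mvar_def mult_single Poly_Mapping.single_add[symmetric])

lemma prod_single: "(\<Prod>v\<in>S. Poly_Mapping.single (f v) (1::'a::comm_ring_1)) = Poly_Mapping.single (\<Sum>v\<in>S. f v) 1"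
  by (induction S rule: infinite_finite_induct) (simp_all add: mult_single)

lemma monom_eval_mvar: "monom_eval mvar m = Poly_Mapping.single m 1"
  unfolding monom_eval_def mvar_power prod_single sum_singles ..

lemma mconst_mult_single: "mconst c * Poly_Mapping.single m d = Poly_Mapping.single m (c * d)"
  by (simp add: mconst_def mult_single)

context unital_hom
begin

lemma mpoly_subst_superset:
  assumes "finite S" "Poly_Mapping.keys p \<subseteq> S"
  shows "mpoly_subst h x p = (\<Sum>m\<in>S. h (Poly_Mapping.lookup p m) * monom_eval x m)"
  unfolding mpoly_subst_alt using assms
  by (intro sum.mono_neutral_left) (auto simp: not_in_keys_iff_lookup_eq_zero hom_zero)

lemma mpoly_subst_add: "mpoly_subst h x (p + q) = mpoly_subst h x p + mpoly_subst h x q"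
proof -
  let ?S = "Poly_Mapping.keys p \<union> Poly_Mapping.keys q"
  have "mpoly_subst h x (p + q) = (\<Sum>m\<in>?S. h (Poly_Mapping.lookup (p + q) m) * monom_eval x m)"
    using Poly_Mapping.keys_add[of p q] by (intro mpoly_subst_superset) auto
  also have "\<dots> = mpoly_subst h x p + mpoly_subst h x q"
    by (simp add: mpoly_subst_superset[of ?S] lookup_add hom_add distrib_right sum.distrib)
  finally show ?thesis .
qed

lemma mpoly_subst_single: "mpoly_subst h x (Poly_Mapping.single m c) = h c * monom_eval x m"
  by (cases "c = 0") (simp_all add: mpoly_subst_alt hom_zero)

lemma mpoly_subst_0: "mpoly_subst h x 0 = 0"
  by (simp add: mpoly_subst_alt)

lemma mpoly_subst_sum: "mpoly_subst h x (sum f I) = (\<Sum>i\<in>I. mpoly_subst h x (f i))"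
  by (induction I rule: infinite_finite_induct) (simp_all add: mpoly_subst_0 mpoly_subst_add)

lemma mpoly_subst_mult: "mpoly_subst h x (p * q) = mpoly_subst h x p * mpoly_subst h x q"
proof -
  let ?t = "\<lambda>p m. Poly_Mapping.single m (Poly_Mapping.lookup p m)"
  have "p * q = (\<Sum>m\<in>Poly_Mapping.keys p. ?t p m) * (\<Sum>n\<in>Poly_Mapping.keys q. ?t q n)"
    by (simp add: sum_singles)
  also have "mpoly_subst h x \<dots> = (\<Sum>m\<in>Poly_Mapping.keys p. \<Sum>n\<in>Poly_Mapping.keys q.
      (h (Poly_Mapping.lookup p m) * monom_eval x m) * (h (Poly_Mapping.lookup q n) * monom_eval x n))"
    by (simp add: sum_product mpoly_subst_sum mult_single mpoly_subst_single hom_mult monom_eval_add mult_ac)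
  also have "\<dots> = mpoly_subst h x p * mpoly_subst h x q"
    by (simp add: mpoly_subst_alt sum_product)
  finally show ?thesis .
qed

lemma mpoly_subst_mconst: "mpoly_subst h x (mconst c) = h c"
  by (simp add: mconst_def mpoly_subst_single monom_eval_def)

lemma mpoly_subst_mvar: "mpoly_subst h x (mvar v) = x v"
  by (simp add: mvar_def mpoly_subst_single monom_eval_single hom_one)

lemma unital_hom_mpoly_subst: "unital_hom (mpoly_subst h x)"
proof
  have "1 = mconst (1::'a)" by (simp add: mconst_def)
  then show "mpoly_subst h x 1 = 1" using mpoly_subst_mconst hom_one by metis
qed (simp_all add: mpoly_subst_add mpoly_subst_mult)

lemma hom_mpoly_subst: "h (mpoly_subst g x p) = mpoly_subst (\<lambda>c. h (g c)) (\<lambda>v. h (x v)) p"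
  by (simp add: mpoly_subst_def hom_sum hom_mult hom_prod hom_power)

end

definition mpolys_in :: "'v set \<Rightarrow> ('v, 'a::comm_ring_1) mpoly set" where
  "mpolys_in V = {p. \<forall>m\<in>Poly_Mapping.keys p. Poly_Mapping.keys m \<subseteq> V}"

lemma mpolys_in_UNIV: "mpolys_in UNIV = UNIV"
  by (simp add: mpolys_in_def)

lemma mpolys_in_mono: "V \<subseteq> W \<Longrightarrow> mpolys_in V \<subseteq> mpolys_in W"
  by (auto simp: mpolys_in_def)

lemma mpoly_subst_cong:
  assumes "p \<in> mpolys_in V" "\<And>v. v \<in> V \<Longrightarrow> x v = y v"
  shows "mpoly_subst h x p = mpoly_subst h y p"
  using assms unfolding mpoly_subst_alt mpolys_in_def
  by (intro sum.cong) (auto intro!: arg_cong2[of _ _ _ _ "(*)"] monom_eval_cong)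

lemma subring_mpolys_in: "subring_set (mpolys_in V :: ('v, 'a::comm_ring_1) mpoly set)"
proof (rule subring_setI)
  show "1 \<in> mpolys_in V" by (simp add: mpolys_in_def)
  fix p q :: "('v, 'a) mpoly" assume pq: "p \<in> mpolys_in V" "q \<in> mpolys_in V"
  show "p - q \<in> mpolys_in V" unfolding mpolys_in_def
  proof (intro CollectI ballI)
    fix m assume "m \<in> Poly_Mapping.keys (p - q)"
    then have "m \<in> Poly_Mapping.keys p \<or> m \<in> Poly_Mapping.keys q" by (auto simp: in_keys_iff lookup_minus)
    then show "Poly_Mapping.keys m \<subseteq> V" using pq by (auto simp: mpolys_in_def)
  qed
  show "p * q \<in> mpolys_in V" unfolding mpolys_in_def
  proof (intro CollectI ballI)
    fix m assume "m \<in> Poly_Mapping.keys (p * q)"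
    then obtain a b where "m = a + b" "a \<in> Poly_Mapping.keys p" "b \<in> Poly_Mapping.keys q"
      using keys_mult[of p q] by blast
    then show "Poly_Mapping.keys m \<subseteq> V" using pq Poly_Mapping.keys_add[of a b] unfolding mpolys_in_def by blast
  qed
qed

lemma mconst_mpolys_in: "mconst c \<in> mpolys_in V"
  by (simp add: mpolys_in_def mconst_def)

lemma mvar_mpolys_in: "v \<in> V \<Longrightarrow> mvar v \<in> mpolys_in V"
  by (simp add: mpolys_in_def mvar_def)

text \<open>
  The polynomial ring in the variables \<open>V\<close> is generated by the constants and the
  variables: a term is a constant times the value of its monomial at the variables themselves.
\<close>

lemma mpolys_in_induct [consumes 1, case_names const var add mult]:
  assumes p: "p \<in> mpolys_in V"
    and const: "\<And>c. P (mconst c)" and var: "\<And>v. v \<in> V \<Longrightarrow> P (mvar v)"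
    and add: "\<And>p q. P p \<Longrightarrow> P q \<Longrightarrow> P (p + q)" and mult: "\<And>p q. P p \<Longrightarrow> P q \<Longrightarrow> P (p * q)"
  shows "P p"
proof -
  have one: "P 1" and zero: "P 0" using const[of 1] const[of 0] by (simp_all add: mconst_def)
  have pow: "P q \<Longrightarrow> P (q ^ n)" for q n by (induction n) (auto intro: one mult)
  have prod: "(\<And>i. i \<in> I \<Longrightarrow> P (f i)) \<Longrightarrow> P (prod f I)" for I and f :: "'a \<Rightarrow> _"
    by (induction I rule: infinite_finite_induct) (auto intro: one mult)
  have sum: "(\<And>i. i \<in> I \<Longrightarrow> P (f i)) \<Longrightarrow> P (sum f I)" for I and f :: "('a \<Rightarrow>\<^sub>0 nat) \<Rightarrow> _"
    by (induction I rule: infinite_finite_induct) (auto intro: zero add)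
  have "P (Poly_Mapping.single m (Poly_Mapping.lookup p m))" if m: "m \<in> Poly_Mapping.keys p" for m
  proof -
    have "P (monom_eval mvar m)" unfolding monom_eval_def
      using m p by (intro prod pow var) (auto simp: mpolys_in_def)
    then have "P (mconst (Poly_Mapping.lookup p m) * monom_eval mvar m)" by (intro mult const)
    then show ?thesis by (simp add: monom_eval_mvar mconst_mult_single)
  qed
  then have "P (\<Sum>m\<in>Poly_Mapping.keys p. Poly_Mapping.single m (Poly_Mapping.lookup p m))" by (rule sum)
  then show ?thesis by (simp add: sum_singles)
qed

section \<open>Substituting for all variables but one\<close>

text \<open>
  The coefficient of the \<open>k\<close>-th power of the variable \<open>i\<close>, as a polynomial
  in the other variables. In each monomial that occurs, the exponent of \<open>i\<close> is exactly
  \<open>k\<close>, so the truncated subtraction removes the variable \<open>i\<close>.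
\<close>

definition coeff_in :: "'v \<Rightarrow> nat \<Rightarrow> ('v, 'a::comm_ring_1) mpoly \<Rightarrow> ('v, 'a) mpoly" where
  "coeff_in i k p = (\<Sum>m\<in>{m\<in>Poly_Mapping.keys p. Poly_Mapping.lookup m i = k}.
     Poly_Mapping.single (m - Poly_Mapping.single i k) (Poly_Mapping.lookup p m))"

lemma coeff_in_mpolys_in:
  assumes "p \<in> mpolys_in (insert i V)"
  shows "coeff_in i k p \<in> mpolys_in V"
  unfolding coeff_in_def
proof (rule subring_set_sum[OF subring_mpolys_in])
  fix m assume m: "m \<in> {m\<in>Poly_Mapping.keys p. Poly_Mapping.lookup m i = k}"
  then have "Poly_Mapping.keys m \<subseteq> insert i V" using assms by (auto simp: mpolys_in_def)
  moreover have "Poly_Mapping.keys (m - Poly_Mapping.single i k) \<subseteq> Poly_Mapping.keys m - {i}"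
    using m by (auto simp: in_keys_iff lookup_minus lookup_single)
  ultimately show "Poly_Mapping.single (m - Poly_Mapping.single i k) (Poly_Mapping.lookup p m) \<in> mpolys_in V"
    by (auto simp: mpolys_in_def)
qed

lemma split_off_single:
  "Poly_Mapping.lookup m i = (k::nat) \<Longrightarrow> m - Poly_Mapping.single i k + Poly_Mapping.single i k = m"
  by (rule poly_mapping_eqI) (auto simp: lookup_add lookup_minus lookup_single when_def)

lemma coeff_in_neq_0:
  assumes m: "m \<in> Poly_Mapping.keys p"
  shows "coeff_in i (Poly_Mapping.lookup m i) p \<noteq> 0"
proof -
  let ?k = "Poly_Mapping.lookup m i"
  let ?s = "Poly_Mapping.single i ?k"
  have eq: "m' - ?s = m - ?s \<longleftrightarrow> m' = m" if "Poly_Mapping.lookup m' i = ?k" for m'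
    using split_off_single[of m' i ?k] split_off_single[of m i ?k] that by metis
  have "Poly_Mapping.lookup (coeff_in i ?k p) (m - ?s) =
      (\<Sum>m'\<in>{m'\<in>Poly_Mapping.keys p. Poly_Mapping.lookup m' i = ?k}. if m' = m then Poly_Mapping.lookup p m' else 0)"
    unfolding coeff_in_def lookup_sum by (rule sum.cong) (auto simp: lookup_single when_def eq)
  also have "\<dots> = Poly_Mapping.lookup p m" using m by simp
  finally show ?thesis using m by (auto simp: in_keys_iff)
qed

lemma coeff_in_eq_0: "k \<notin> (\<lambda>m. Poly_Mapping.lookup m i) ` Poly_Mapping.keys p \<Longrightarrow> coeff_in i k p = 0"
  unfolding coeff_in_def by (rule sum.neutral) auto

lemma monom_eval_all_but:
  fixes x :: "'v \<Rightarrow> 'e::comm_ring_1"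
  shows "monom_eval (\<lambda>j. if j = i then [:0, 1:] else [:x j:]) m =
    Polynomial.monom (monom_eval x (m - Poly_Mapping.single i (Poly_Mapping.lookup m i))) (Poly_Mapping.lookup m i)"
proof -
  let ?k = "Poly_Mapping.lookup m i"
  let ?y = "\<lambda>j. if j = i then [:0, 1:] else [:x j:]"
  let ?m = "m - Poly_Mapping.single i ?k"
  interpret c: unital_hom "\<lambda>c::'e. [:c:]" by (rule unital_hom_const_poly)
  have "monom_eval ?y m = monom_eval ?y ?m * monom_eval ?y (Poly_Mapping.single i ?k)"
    by (simp add: monom_eval_add[symmetric] split_off_single)
  also have "monom_eval ?y ?m = monom_eval (\<lambda>j. [:x j:]) ?m"
    by (rule monom_eval_cong) (auto simp: in_keys_iff lookup_minus lookup_single)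
  also have "\<dots> = [:monom_eval x ?m:]"
    unfolding monom_eval_def poly_const_pow by (rule c.hom_prod[symmetric])
  finally show ?thesis by (simp add: monom_eval_single monom_altdef)
qed

context
  fixes h :: "'k::field \<Rightarrow> 'e::field"
  assumes "unital_hom h"
begin

interpretation unital_hom h by fact

lemma unital_hom_const_comp: "unital_hom (\<lambda>c. [:h c:])"
  by (rule unital_hom_comp[OF unital_hom_const_poly]) unfold_locales

lemma coeff_subst_all_but: "poly.coeff (subst_all_but h x i p) k = mpoly_subst h x (coeff_in i k p)"
proof -
  let ?e = "\<lambda>m. h (Poly_Mapping.lookup p m) * monom_eval x (m - Poly_Mapping.single i (Poly_Mapping.lookup m i))"
  have "poly.coeff (subst_all_but h x i p) k =
      (\<Sum>m\<in>Poly_Mapping.keys p. if Poly_Mapping.lookup m i = k then ?e m else 0)"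
    by (simp add: subst_all_but_def mpoly_subst_alt monom_eval_all_but Polynomial.coeff_sum)
       (rule sum.cong, auto)
  also have "\<dots> = (\<Sum>m\<in>{m\<in>Poly_Mapping.keys p. Poly_Mapping.lookup m i = k}. ?e m)"
    using sum.inter_filter[of "Poly_Mapping.keys p" ?e "\<lambda>m. Poly_Mapping.lookup m i = k"] by simp
  also have "\<dots> = mpoly_subst h x (coeff_in i k p)"
    by (simp add: coeff_in_def mpoly_subst_sum mpoly_subst_single)
  finally show ?thesis .
qed

lemma unital_hom_subst_all_but: "unital_hom (subst_all_but h x i)"
proof -
  have "subst_all_but h x i = mpoly_subst (\<lambda>c. [:h c:]) (\<lambda>j. if j = i then [:0, 1:] else [:x j:])"
    by (auto simp: subst_all_but_def)
  then show ?thesis using unital_hom.unital_hom_mpoly_subst[OF unital_hom_const_comp] by simp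
qed

lemma poly_subst_all_but: "poly (subst_all_but h x i p) (x i) = mpoly_subst h x p"
proof -
  interpret e: unital_hom "\<lambda>p. poly p (x i)" by (rule unital_hom_poly)
  have "(\<lambda>v. poly (if v = i then [:0, 1:] else [:x v:]) (x i)) = x" by auto
  then show ?thesis by (simp add: subst_all_but_def e.hom_mpoly_subst)
qed

text \<open>
  For \<open>h\<close> the embedding of \<open>K\<close>, this is the ring $K[x_v : v \in V]$.
\<close>

definition eval_ring :: "('v \<Rightarrow> 'e) \<Rightarrow> 'v set \<Rightarrow> 'e set" where
  "eval_ring x V = mpoly_subst h x ` mpolys_in V"

lemma subring_eval_ring: "subring_set (eval_ring x V)"
  unfolding eval_ring_def
  by (rule unital_hom.subring_image[OF unital_hom_mpoly_subst subring_mpolys_in])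

lemma eval_ring_const: "h c \<in> eval_ring x V"
  unfolding eval_ring_def by (metis imageI mconst_mpolys_in mpoly_subst_mconst)

lemma eval_ring_var: "v \<in> V \<Longrightarrow> x v \<in> eval_ring x V"
  unfolding eval_ring_def by (metis imageI mvar_mpolys_in mpoly_subst_mvar)

text \<open>
  The coefficients of an image are values of polynomials in \<open>V\<close>. Conversely, the image
  contains the constants of the ring, as values of polynomials without the variable \<open>i\<close>,
  and the indeterminate, as the image of that variable.
\<close>

lemma subst_all_but_image:
  assumes i: "i \<notin> V"
  shows "subst_all_but h x i ` mpolys_in (insert i V) = polys_in (eval_ring x V)"
proof
  note sub = subring_eval_ring[of x V]
  note subp = subring_polys_in[OF sub]
  interpret s: unital_hom "subst_all_but h x i" by (rule unital_hom_subst_all_but)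
  interpret c: unital_hom "\<lambda>c. [:h c:]" by (rule unital_hom_const_comp)
  show "subst_all_but h x i ` mpolys_in (insert i V) \<subseteq> polys_in (eval_ring x V)"
    using coeff_in_mpolys_in by (fastforce simp: polys_in_def coeff_subst_all_but eval_ring_def)
  show "polys_in (eval_ring x V) \<subseteq> subst_all_but h x i ` mpolys_in (insert i V)"
  proof
    fix f assume "f \<in> polys_in (eval_ring x V)"
    then show "f \<in> subst_all_but h x i ` mpolys_in (insert i V)"
    proof (induction f)
      case 0
      show ?case using s.hom_zero subring_set_closed(2)[OF subring_mpolys_in] by (metis imageI)
    next
      case (pCons a f)
      then obtain q p where q: "q \<in> mpolys_in V" "a = mpoly_subst h x q"
        and p: "p \<in> mpolys_in (insert i V)" "f = subst_all_but h x i p"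
        unfolding pCons_polys_in[OF sub] by (auto simp: eval_ring_def)
      have "subst_all_but h x i q = mpoly_subst (\<lambda>c. [:h c:]) (\<lambda>j. [:x j:]) q"
        unfolding subst_all_but_def using i by (intro mpoly_subst_cong[OF q(1)]) auto
      also have "\<dots> = [:a:]"
        unfolding q(2) by (rule unital_hom.hom_mpoly_subst[OF unital_hom_const_poly, symmetric])
      finally have 1: "subst_all_but h x i q = [:a:]" .
      have 2: "subst_all_but h x i (mvar i) = [:0, 1:]"
        by (simp add: subst_all_but_def c.mpoly_subst_mvar)
      have "subst_all_but h x i (q + mvar i * p) = pCons a f"
        using 1 2 p by (simp add: s.hom_add s.hom_mult)
      moreover have "q + mvar i * p \<in> mpolys_in (insert i V)"
        using p q mpolys_in_mono[of V "insert i V"] mvar_mpolys_in[of i "insert i V"]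
        by (intro subring_set_closed[OF subring_mpolys_in]) auto
      ultimately show ?case by (metis imageI)
    qed
  qed
qed

text \<open>
  Independence of a family rather than of a set of elements: it includes injectivity of
  \<open>x\<close> on \<open>V\<close>, so repeated values are dependent.
\<close>

definition indep_on :: "('v \<Rightarrow> 'e) \<Rightarrow> 'v set \<Rightarrow> bool" where
  "indep_on x V \<longleftrightarrow> (\<forall>p\<in>mpolys_in V. mpoly_subst h x p = 0 \<longrightarrow> p = 0)"

lemma indep_on_mono: "indep_on x W \<Longrightarrow> V \<subseteq> W \<Longrightarrow> indep_on x V"
  using mpolys_in_mono unfolding indep_on_def by blast

text \<open>
  The coefficients of the image are the values of the coefficients of \<open>p\<close> with respect
  to \<open>i\<close>, and these values are zero only for the zero polynomial by independence.
\<close>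

lemma subst_all_but_eq_0_iff:
  assumes V: "indep_on x V" and p: "p \<in> mpolys_in (insert i V)"
  shows "subst_all_but h x i p = 0 \<longleftrightarrow> p = 0"
proof
  interpret s: unital_hom "subst_all_but h x i" by (rule unital_hom_subst_all_but)
  show "p = 0 \<Longrightarrow> subst_all_but h x i p = 0" by (simp add: s.hom_zero)
  assume z: "subst_all_but h x i p = 0"
  have "coeff_in i k p = 0" for k
    using V coeff_subst_all_but[of x i p k] coeff_in_mpolys_in[OF p] z by (auto simp: indep_on_def)
  then have "Poly_Mapping.keys p = {}" using coeff_in_neq_0[of _ p i] by fastforce
  then show "p = 0" by (simp add: keys_eq_empty)
qed

lemma degree_subst_all_but:
  assumes V: "indep_on x V" and p: "p \<in> mpolys_in (insert i V)"
  shows "Polynomial.degree (subst_all_but h x i p) = deg_in i p"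
proof (cases "p = 0")
  case True
  then show ?thesis using subst_all_but_eq_0_iff[OF V p] by (simp add: deg_in_def)
next
  case False
  let ?D = "(\<lambda>m. Poly_Mapping.lookup m i) ` Poly_Mapping.keys p"
  have D: "?D \<noteq> {}" "finite ?D" using False by auto
  have d: "deg_in i p = Max ?D" unfolding deg_in_def using D by (simp add: Max_insert)
  have coeff: "poly.coeff (subst_all_but h x i p) k = 0 \<longleftrightarrow> coeff_in i k p = 0" for k
    using V coeff_in_mpolys_in[OF p] by (auto simp: coeff_subst_all_but indep_on_def mpoly_subst_0)
  have "Max ?D \<in> ?D" using D by simp
  then have "poly.coeff (subst_all_but h x i p) (Max ?D) \<noteq> 0"
    unfolding coeff using coeff_in_neq_0 by fastforce
  moreover have "poly.coeff (subst_all_but h x i p) k = 0" if "k > Max ?D" for k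
    unfolding coeff using that D by (intro coeff_in_eq_0) (meson Max_ge leD)
  ultimately show ?thesis unfolding d
    by (meson Polynomial.degree_le le_antisym le_degree)
qed

end

lemma inj_subst_all_but:
  assumes h: "unital_hom h" and V: "indep_on h x V"
  shows "inj_on (subst_all_but h x i) (mpolys_in (insert i V))"
proof (rule inj_onI)
  interpret s: unital_hom "subst_all_but h x i" by (rule unital_hom_subst_all_but[OF h])
  fix p q assume "p \<in> mpolys_in (insert i V)" "q \<in> mpolys_in (insert i V)"
    "subst_all_but h x i p = subst_all_but h x i q"
  then have "p - q = 0" using subst_all_but_eq_0_iff[OF h V, of "p - q" i]
    subring_set_closed(3)[OF subring_mpolys_in] by (auto simp: s.hom_diff)
  then show "p = q" by simp
qed

section \<open>Rings generated by independent elements\<close>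

lemma factorial_in_field:
  assumes "subring_set A" "\<And>a. a \<in> A \<Longrightarrow> a \<noteq> 0 \<Longrightarrow> divides_in A a 1"
  shows "factorial_in A"
proof -
  have "length_on A (\<lambda>_. 0)" using assms(2) by (auto simp: length_on_def)
  moreover have "\<not> irreducible_in A p" for p using assms(2) by (auto simp: irreducible_in_def)
  ultimately show ?thesis using assms(1) unfolding factorial_in_def by blast
qed

lemma eval_ring_empty:
  assumes "unital_hom h"
  shows "eval_ring h x {} = range h"
proof
  interpret unital_hom h by fact
  show "range h \<subseteq> eval_ring h x {}" using eval_ring_const[OF assms] by auto
  show "eval_ring h x {} \<subseteq> range h"
  proof
    fix y assume "y \<in> eval_ring h x {}"
    then obtain p where p: "p \<in> mpolys_in {}" "y = mpoly_subst h x p" by (auto simp: eval_ring_def[OF assms])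
    from p(1) have "mpoly_subst h x p \<in> range h"
      by (induction rule: mpolys_in_induct)
        (auto simp: mpoly_subst_mconst mpoly_subst_add mpoly_subst_mult hom_add[symmetric] hom_mult[symmetric])
    then show "y \<in> range h" using p by simp
  qed
qed

lemma eval_ring_insert:
  assumes h: "unital_hom h" and v: "v \<notin> V"
  shows "eval_ring h x (insert v V) = (\<lambda>f. poly f (x v)) ` polys_in (eval_ring h x V)"
proof -
  have "(\<lambda>f. poly f (x v)) ` polys_in (eval_ring h x V) =
      (\<lambda>f. poly f (x v)) ` subst_all_but h x v ` mpolys_in (insert v V)"
    by (simp only: subst_all_but_image[OF h v])
  also have "\<dots> = eval_ring h x (insert v V)"
    by (simp only: image_image poly_subst_all_but[OF h] eval_ring_def[OF h])
  finally show ?thesis ..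
qed

text \<open>
  Adjoining the elements one at a time, each new element \<open>x v\<close> is transcendental over
  the ring \<open>A\<close> generated so far, so evaluation at \<open>x v\<close> identifies
  \<open>A[X]\<close> with the next ring.
\<close>

theorem factorial_in_eval_ring:
  fixes h :: "'k::field \<Rightarrow> 'e::field"
  assumes h: "unital_hom h" and "finite V" "indep_on h x V"
  shows "factorial_in (eval_ring h x V)"
  using assms(2,3)
proof (induction V)
  case empty
  interpret unital_hom h by fact
  show ?case unfolding eval_ring_empty[OF h]
  proof (rule factorial_in_field)
    show "subring_set (range h)" using subring_eval_ring[OF h, of x "{}"] by (simp add: eval_ring_empty[OF h])
    fix a assume "a \<in> range h" "a \<noteq> 0"
    then obtain c where c: "a = h c" "c \<noteq> 0" using hom_zero by auto
    then have "1 = a * h (1 / c)" by (simp add: hom_mult[symmetric] hom_one)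
    then show "divides_in (range h) a 1" unfolding divides_in_def by blast
  qed
next
  case (insert v V)
  have V: "indep_on h x V" using insert.prems indep_on_mono[OF h] by blast
  interpret unital_hom h by fact
  show ?case unfolding eval_ring_insert[OF h insert.hyps(2)]
  proof (rule factorial_in_image)
    show "factorial_in (polys_in (eval_ring h x V))" using insert.IH V by (intro factorial_in_polys_in)
    show "inj_on (\<lambda>f. poly f (x v)) (polys_in (eval_ring h x V))"
      unfolding subst_all_but_image[OF h insert.hyps(2), symmetric]
    proof (rule inj_onI)
      fix f g
      assume "f \<in> subst_all_but h x v ` mpolys_in (insert v V)" "g \<in> subst_all_but h x v ` mpolys_in (insert v V)"
        and eq: "poly f (x v) = poly g (x v)"
      then obtain p q where pq: "p \<in> mpolys_in (insert v V)" "q \<in> mpolys_in (insert v V)"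
        "f = subst_all_but h x v p" "g = subst_all_but h x v q" by auto
      have "mpoly_subst h x (p - q) = 0"
        using eq unfolding pq poly_subst_all_but[OF h] unital_hom.hom_diff[OF unital_hom_mpoly_subst] by simp
      moreover have "p - q \<in> mpolys_in (insert v V)" using pq subring_set_closed(3)[OF subring_mpolys_in] by blast
      ultimately have "p - q = 0" using insert.prems unfolding indep_on_def[OF h] by blast
      then show "f = g" using pq by simp
    qed
  qed simp_all
qed

section \<open>Fields of fractions and algebraic elements\<close>

interpretation type_ring: domain "ring_of_type_algebra :: 'e::field ring"
  by (rule field.axioms(1)[OF field_from_type_algebra])

lemma type_ring_simps [simp]:
  "carrier (ring_of_type_algebra :: 'e::field ring) = UNIV"
  "a \<otimes>\<^bsub>ring_of_type_algebra\<^esub> b = a * (b::'e)" "a \<oplus>\<^bsub>ring_of_type_algebra\<^esub> b = a + b"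
  "\<one>\<^bsub>ring_of_type_algebra\<^esub> = (1::'e)" "\<zero>\<^bsub>ring_of_type_algebra\<^esub> = (0::'e)"
  by (simp_all add: ring_of_type_algebra_def)

lemma type_ring_a_inv [simp]: "\<ominus>\<^bsub>ring_of_type_algebra\<^esub> (a::'e::field) = - a"
  using type_ring.minus_equality[of "-a" a] by simp

lemma type_ring_m_inv [simp]: "a \<noteq> 0 \<Longrightarrow> inv\<^bsub>ring_of_type_algebra\<^esub> (a::'e::field) = inverse a"
  using type_ring.comm_inv_char[of a "inverse a"] by simp

lemma type_ring_pow [simp]: "(a::'e::field) [^]\<^bsub>ring_of_type_algebra\<^esub> (n::nat) = a ^ n"
  by (induction n) (simp_all add: mult.commute)

abbreviation subfield_set :: "'e::field set \<Rightarrow> bool" where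
  "subfield_set F \<equiv> subfield F ring_of_type_algebra"

lemma subfield_setI:
  assumes F: "subring_set F" and inv: "\<And>x. x \<in> F \<Longrightarrow> inverse x \<in> F"
  shows "subfield_set F"
proof (rule field.subfieldI'[OF field_from_type_algebra])
  show "subring F ring_of_type_algebra"
    by (rule type_ring.subringI) (auto intro: subring_set_closed[OF F])
qed (use inv in auto)

lemma subfield_set_subring: "subfield_set F \<Longrightarrow> subring_set F"
proof (rule subring_setI)
  assume "subfield_set F"
  then have s: "subring F ring_of_type_algebra" by (rule subfieldE(1))
  note c = subringE[OF s, simplified]
  show "1 \<in> F" using c by auto
  show "x - y \<in> F" "x * y \<in> F" if "x \<in> F" "y \<in> F" for x y
    using c(7)[of x "- y"] c(5)[of y] c(6) that by auto
qed

lemma subfield_set_inverse: "subfield_set F \<Longrightarrow> x \<in> F \<Longrightarrow> inverse x \<in> F"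
  using type_ring.subfield_m_inv(1)[of F x] by (cases "x = 0") auto

definition fractions :: "'e::field set \<Rightarrow> 'e set" where
  "fractions A = {a / b |a b. a \<in> A \<and> b \<in> A \<and> b \<noteq> 0}"

lemma subfield_fractions:
  assumes A: "subring_set A"
  shows "subfield_set (fractions A)"
proof (rule subfield_setI)
  note cl = subring_set_closed[OF A]
  show "subring_set (fractions A)"
  proof (rule subring_setI)
    have "1 = 1 / (1::'a)" by simp
    then show "1 \<in> fractions A" unfolding fractions_def using cl(1) by (metis (mono_tags, lifting) mem_Collect_eq zero_neq_one)
    fix x y assume "x \<in> fractions A" "y \<in> fractions A"
    then obtain a b c d where ab: "a \<in> A" "b \<in> A" "b \<noteq> 0" "x = a / b" "c \<in> A" "d \<in> A" "d \<noteq> 0" "y = c / d"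
      unfolding fractions_def by blast
    have "x - y = (a * d - c * b) / (b * d)" "x * y = (a * c) / (b * d)"
      using ab by (simp_all add: field_simps)
    moreover have "a * d - c * b \<in> A" "a * c \<in> A" "b * d \<in> A" "b * d \<noteq> 0" using ab by (auto intro: cl)
    ultimately show "x - y \<in> fractions A" "x * y \<in> fractions A" unfolding fractions_def by blast+
  qed
  fix x assume "x \<in> fractions A"
  then obtain a b where ab: "a \<in> A" "b \<in> A" "b \<noteq> 0" "x = a / b" unfolding fractions_def by blast
  show "inverse x \<in> fractions A"
  proof (cases "a = 0")
    case True
    then have "inverse x = 0 / b" using ab by simp
    then show ?thesis unfolding fractions_def using ab cl(2) by blast
  next
    case False
    then have "inverse x = b / a" using ab by simp
    then show ?thesis unfolding fractions_def using ab False by blast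
  qed
qed

lemma subset_fractions: "subring_set A \<Longrightarrow> A \<subseteq> fractions A"
proof
  fix a assume "subring_set A" "a \<in> A"
  then have "a = a / 1 \<and> a \<in> A \<and> 1 \<in> A \<and> (1::'a) \<noteq> 0" by (auto intro: subring_set_closed)
  then show "a \<in> fractions A" unfolding fractions_def by blast
qed

lemma fractions_minimal:
  assumes "subfield_set F" "A \<subseteq> F"
  shows "fractions A \<subseteq> F"
  using assms subring_set_closed(6)[OF subfield_set_subring[OF assms(1)]] subfield_set_inverse[OF assms(1)]
  unfolding fractions_def divide_inverse by blast

lemma clear_denominators:
  assumes A: "subring_set A" and "f \<in> polys_in (fractions A)"
  shows "\<exists>d\<in>A. d \<noteq> 0 \<and> Polynomial.smult d f \<in> polys_in A"
  using assms(2)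
proof (induction f)
  case 0
  show ?case using subring_set_closed(1)[OF A] subring_set_closed(2)[OF subring_polys_in[OF A]]
    by (intro bexI[of _ 1]) auto
next
  case (pCons c f)
  note F = subfield_set_subring[OF subfield_fractions[OF A]]
  obtain d where d: "d \<in> A" "d \<noteq> 0" "Polynomial.smult d f \<in> polys_in A"
    using pCons pCons_polys_in[OF F] by blast
  obtain a b where ab: "a \<in> A" "b \<in> A" "b \<noteq> 0" "c = a / b"
    using pCons.prems pCons_polys_in[OF F] unfolding fractions_def by blast
  have "b * d * c = d * a" using ab by simp
  then have "Polynomial.smult (b * d) (pCons c f) = pCons (d * a) (Polynomial.smult b (Polynomial.smult d f))"
    by simp
  also have "\<dots> \<in> polys_in A"
    using ab d smult_polys_in[OF A] pCons_polys_in[OF A] subring_set_closed(6)[OF A] by blast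
  finally show ?case using ab d subring_set_closed(6)[OF A] by (metis no_zero_divisors)
qed

definition alg_over :: "'e::field set \<Rightarrow> 'e \<Rightarrow> bool" where
  "alg_over F x \<longleftrightarrow> (\<exists>p\<in>polys_in F. p \<noteq> 0 \<and> poly p x = 0)"

lemma alg_over_mono: "F \<subseteq> G \<Longrightarrow> alg_over F x \<Longrightarrow> alg_over G x"
  by (fastforce simp: alg_over_def polys_in_def)

lemma alg_over_self: "subring_set F \<Longrightarrow> x \<in> F \<Longrightarrow> alg_over F x"
  unfolding alg_over_def
  by (rule bexI[of _ "[:-x, 1:]"]) (simp_all add: pCons_polys_in subring_polys_in subring_set_closed)

lemma alg_over_fractions_iff:
  assumes A: "subring_set A"
  shows "alg_over (fractions A) x \<longleftrightarrow> alg_over A x"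
proof
  assume "alg_over (fractions A) x"
  then obtain f where f: "f \<in> polys_in (fractions A)" "f \<noteq> 0" "poly f x = 0" by (auto simp: alg_over_def)
  then obtain d where "d \<in> A" "d \<noteq> 0" "Polynomial.smult d f \<in> polys_in A" using clear_denominators[OF A] by blast
  then show "alg_over A x" using f by (auto simp: alg_over_def intro!: bexI[of _ "Polynomial.smult d f"])
qed (rule alg_over_mono[OF subset_fractions[OF A]])

text \<open>
  The polynomials over a ring record are lists of coefficients with the leading coefficient first.
\<close>

lemma eval_eq_poly: "type_ring.eval xs x = poly (Poly (rev xs)) x"
  by (induction xs) (simp_all add: Poly_snoc poly_monom)

lemma mem_univ_poly_iff:
  "xs \<in> carrier (univ_poly ring_of_type_algebra F) \<longleftrightarrow> xs = [] \<or> set xs \<subseteq> F \<and> hd xs \<noteq> (0::'e::field)"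
  by (simp add: univ_poly_def polynomial_def)

lemma univ_poly_to_poly:
  fixes F :: "'e::field set"
  assumes "subring_set F" "xs \<in> carrier (univ_poly ring_of_type_algebra F)" "xs \<noteq> []"
  shows "Poly (rev xs) \<in> polys_in F" "Poly (rev xs) \<noteq> 0" "Polynomial.degree (Poly (rev xs)) = length xs - 1"
proof -
  have xs: "set xs \<subseteq> F" "hd xs \<noteq> 0" using assms by (auto simp: mem_univ_poly_iff)
  show "Poly (rev xs) \<in> polys_in F"
    using xs subring_set_closed(2)[OF assms(1)] by (auto simp: polys_in_def nth_default_def rev_nth)
  have "coeffs (Poly (rev xs)) = rev xs"
    using xs assms(3) by (cases xs) (auto simp: strip_while_def)
  then show "Poly (rev xs) \<noteq> 0" "Polynomial.degree (Poly (rev xs)) = length xs - 1"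
    using assms(3) by (metis coeffs_0_eq_Nil rev_is_Nil_conv, metis degree_eq_length_coeffs length_rev)
qed

lemma poly_to_univ_poly:
  fixes F :: "'e::field set"
  assumes "p \<in> polys_in F" "p \<noteq> 0"
  shows "rev (coeffs p) \<in> carrier (univ_poly ring_of_type_algebra F)" "rev (coeffs p) \<noteq> []"
  using assms last_coeffs_eq_coeff_degree[of p] by (auto simp: mem_univ_poly_iff hd_rev polys_in_def coeffs_def)

lemma algebraic_iff_alg_over:
  assumes F: "subfield_set F"
  shows "ring.algebraic ring_of_type_algebra F x \<longleftrightarrow> alg_over F x"
proof
  assume "ring.algebraic ring_of_type_algebra F x"
  then obtain xs where xs: "xs \<in> carrier (univ_poly ring_of_type_algebra F)" "xs \<noteq> []" "type_ring.eval xs x = 0"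
    using type_ring.algebraicE[OF subfieldE(1)[OF F], of x] unfolding over_def by auto
  show "alg_over F x" unfolding alg_over_def
    using univ_poly_to_poly[OF subfield_set_subring[OF F] xs(1,2)] xs(3) eval_eq_poly by metis
next
  assume "alg_over F x"
  then obtain p where p: "p \<in> polys_in F" "p \<noteq> 0" "poly p x = 0" by (auto simp: alg_over_def)
  show "ring.algebraic ring_of_type_algebra F x"
    using type_ring.algebraicI[OF poly_to_univ_poly[OF p(1,2)], of x] p(3)
    unfolding over_def by (simp add: eval_eq_poly)
qed

lemma generate_field_subfield: "subfield_set (generate_field ring_of_type_algebra S)"
  by (rule field.generate_field_is_subfield[OF field_from_type_algebra]) simp

lemma generate_field_minimal: "subfield_set F \<Longrightarrow> S \<subseteq> F \<Longrightarrow> generate_field ring_of_type_algebra S \<subseteq> F"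
  by (rule field.generate_field_min_subfield1[OF field_from_type_algebra]) simp_all

lemma generate_field_superset: "S \<subseteq> generate_field ring_of_type_algebra S"
  by (auto intro: generate_field.incl)

lemma simple_extension_eq_generate_field:
  assumes F: "subfield_set F" and b: "alg_over F b"
  shows "type_ring.simple_extension F b = generate_field ring_of_type_algebra (F \<union> {b})"
proof
  have alg: "(type_ring.algebraic over F) b" using b algebraic_iff_alg_over[OF F] by (simp add: over_def)
  let ?G = "generate_field ring_of_type_algebra (F \<union> {b})"
  show "type_ring.simple_extension F b \<subseteq> ?G"
    using generate_field_superset[of "F \<union> {b}"]
    by (intro type_ring.simple_extension_subring_incl subfieldE(1)[OF generate_field_subfield]) auto
  show "?G \<subseteq> type_ring.simple_extension F b"
    using type_ring.simple_extension_is_subfield[OF F, of b] alg type_ring.simple_extension_incl[of F b]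
      type_ring.simple_extension_mem[OF subfieldE(1)[OF F], of b]
    by (intro generate_field_minimal) auto
qed

text \<open>
  The minimal polynomial \<^term>\<open>ring.Irr ring_of_type_algebra F b\<close> divides
  \<open>m\<close>, and \<open>m\<close> has least degree among the polynomials that vanish at
  \<open>b\<close>; so both have the degree of the extension.
\<close>

lemma ext_degree_simple:
  assumes F: "subfield_set F" and m: "m \<in> polys_in F" "m \<noteq> 0" "poly m b = 0"
    and min: "\<And>g. g \<in> polys_in F \<Longrightarrow> g \<noteq> 0 \<Longrightarrow> poly g b = 0 \<Longrightarrow> Polynomial.degree m \<le> Polynomial.degree g"
  shows "ext_degree F (generate_field ring_of_type_algebra (F \<union> {b})) (Polynomial.degree m)"
proof -
  have b: "alg_over F b" using m by (auto simp: alg_over_def)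
  then have alg: "(type_ring.algebraic over F) b" using algebraic_iff_alg_over[OF F] by (simp add: over_def)
  let ?I = "type_ring.Irr F b"
  note I = type_ring.IrrE[OF F _ alg, simplified]
  \<comment> \<open>a polynomial of positive degree is not the empty list, which represents zero\<close>
  have "length ?I - 1 \<ge> 1" using type_ring.pirreducible_degree[OF F I(1,2)] by simp
  then have ne: "?I \<noteq> []" by auto
  note P = univ_poly_to_poly[OF subfield_set_subring[OF F] I(1) ne]
  have "Polynomial.degree m \<le> length ?I - 1"
    using min[OF P(1,2)] I(4) P(3) by (simp add: eval_eq_poly)
  moreover have "length ?I - 1 \<le> Polynomial.degree m"
  proof -
    note l = poly_to_univ_poly[OF m(1,2)]
    note d = type_ring.Irr_minimal[OF F _ alg l(1)]
    show ?thesis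
      using type_ring.pdivides_imp_degree_le[OF subfieldE(1)[OF F] I(1) l d] m(3)
      by (simp add: degree_eq_length_coeffs eval_eq_poly)
  qed
  ultimately show ?thesis
    using type_ring.dimension_simple_extension[OF F _ alg]
    by (simp add: ext_degree_def simple_extension_eq_generate_field[OF F b])
qed

text \<open>
  Both steps of \<open>F \<subseteq> F(c) \<subseteq> F(c, x)\<close> are finite, hence so is the
  whole extension, and it contains \<open>x\<close>.
\<close>

lemma alg_over_trans:
  assumes F: "subfield_set F" and c: "alg_over F c"
    and x: "alg_over (generate_field ring_of_type_algebra (F \<union> {c})) x"
  shows "alg_over F x"
proof -
  let ?G = "generate_field ring_of_type_algebra (F \<union> {c})"
  let ?H = "type_ring.simple_extension ?G x"
  have G: "subfield_set ?G" by (rule generate_field_subfield)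
  have algx: "(type_ring.algebraic over ?G) x" using x algebraic_iff_alg_over[OF G] by (simp add: over_def)
  have algc: "(type_ring.algebraic over F) c" using c algebraic_iff_alg_over[OF F] by (simp add: over_def)
  have "type_ring.finite_dimension F ?G"
    using type_ring.finite_dimension_simple_extension[OF F, of c] algc
    by (simp add: simple_extension_eq_generate_field[OF F c])
  moreover have "type_ring.finite_dimension ?G ?H"
    using type_ring.finite_dimension_simple_extension[OF G, of x] algx by simp
  ultimately have "type_ring.finite_dimension F ?H" by (rule type_ring.telescopic_base_dim(1)[OF F G])
  moreover have "subring ?H ring_of_type_algebra"
    using type_ring.simple_extension_is_subring[OF subfieldE(1)[OF G], of x] by simp
  moreover have "x \<in> ?H" using type_ring.simple_extension_mem[OF subfieldE(1)[OF G], of x] by simp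
  ultimately have "(type_ring.algebraic over F) x" by (intro type_ring.finite_dimension_imp_algebraic[OF F])
  then show ?thesis using algebraic_iff_alg_over[OF F] by (simp add: over_def)
qed

section \<open>Exchange and transcendence degree\<close>

text \<open>
  A relation of \<open>x\<close> over \<open>F(y)\<close> becomes, after clearing denominators, a
  double sum in powers of \<open>x\<close> and \<open>y\<close> over \<open>F\<close>. Read as a
  polynomial in \<open>y\<close>, its coefficients are the values \<open>H j\<close> at
  \<open>x\<close> of polynomials over \<open>F\<close>; some \<open>H j\<close> is nonzero, and its
  value is nonzero because \<open>x\<close> is transcendental over \<open>F\<close>.
\<close>

lemma alg_over_exchange:
  assumes F: "subfield_set F" and x: "alg_over (generate_field ring_of_type_algebra (F \<union> {y})) x"
    and nx: "\<not> alg_over F x"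
  shows "alg_over (generate_field ring_of_type_algebra (F \<union> {x})) y"
proof -
  let ?A = "(\<lambda>p. poly p y) ` polys_in F"
  note subF = subfield_set_subring[OF F]
  have A: "subring_set ?A" by (rule unital_hom.subring_image[OF unital_hom_poly subring_polys_in[OF subF]])
  have "generate_field ring_of_type_algebra (F \<union> {y}) \<subseteq> fractions ?A"
  proof (rule generate_field_minimal[OF subfield_fractions[OF A]])
    have "c \<in> ?A" if "c \<in> F" for c
      using imageI[of "[:c:]" "polys_in F" "\<lambda>p. poly p y"] that const_polys_in[OF subF] by simp
    moreover have "y \<in> ?A"
      using imageI[of "[:0, 1:]" "polys_in F" "\<lambda>p. poly p y"] subring_set_closed[OF subF]
      by (simp add: pCons_polys_in[OF subF] subring_set_closed(2)[OF subring_polys_in[OF subF]])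
    ultimately have "F \<union> {y} \<subseteq> ?A" by blast
    then show "F \<union> {y} \<subseteq> fractions ?A" using subset_fractions[OF A] by blast
  qed
  then have "alg_over ?A x" using x alg_over_mono alg_over_fractions_iff[OF A] by blast
  then obtain g where g: "g \<in> polys_in ?A" "g \<noteq> 0" "poly g x = 0" by (auto simp: alg_over_def)
  have "\<exists>p. p \<in> polys_in F \<and> poly p y = poly.coeff g k" for k
    using g(1) unfolding polys_in_def[of ?A] by (auto 0 4 dest: spec[of _ k])
  then obtain P where P: "\<And>k. P k \<in> polys_in F" "\<And>k. poly (P k) y = poly.coeff g k" by metis
  define n where "n = Polynomial.degree g"
  \<comment> \<open>a common bound for the degrees in \<open>y\<close>, so that the summations can be exchanged\<close>
  define M where "M = Max ((\<lambda>k. Polynomial.degree (P k)) ` {..n})"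
  have degP: "Polynomial.degree (P k) \<le> M" if "k \<le> n" for k
    using that by (auto simp: M_def intro!: Max_ge)
  have evalP: "poly (P k) y = (\<Sum>j\<le>M. poly.coeff (P k) j * y ^ j)" if "k \<le> n" for k
    unfolding poly_altdef using degP[OF that]
    by (intro sum.mono_neutral_left) (auto simp: coeff_eq_0)
  define H where "H j = (\<Sum>k\<le>n. Polynomial.monom (poly.coeff (P k) j) k)" for j
  have H: "H j \<in> polys_in F" for j unfolding H_def
    using P(1) by (intro subring_set_sum[OF subring_polys_in[OF subF]] monom_polys_in[OF subF]) (auto simp: polys_in_def)
  have coeffH: "poly.coeff (H j) k = poly.coeff (P k) j" if "k \<le> n" for j k
    using that by (simp add: H_def Polynomial.coeff_sum)
  have evalH: "poly (H j) x = (\<Sum>k\<le>n. poly.coeff (P k) j * x ^ k)" for j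
    by (simp add: H_def poly_sum poly_monom)
  define Q where "Q = (\<Sum>j\<le>M. Polynomial.monom (poly (H j) x) j)"
  have coeffQ: "poly.coeff Q j = poly (H j) x" if "j \<le> M" for j
    using that by (simp add: Q_def Polynomial.coeff_sum)
  let ?G = "generate_field ring_of_type_algebra (F \<union> {x})"
  note subG = subfield_set_subring[OF generate_field_subfield[of "F \<union> {x}"]]
  have FG: "F \<subseteq> ?G" "x \<in> ?G" using generate_field_superset[of "F \<union> {x}"] by auto
  have "poly (H j) x \<in> ?G" for j unfolding evalH
    using P(1) FG by (intro subring_set_sum[OF subG] subring_set_closed[OF subG]) (auto simp: polys_in_def)
  then have "Q \<in> polys_in ?G" unfolding Q_def
    by (intro subring_set_sum[OF subring_polys_in[OF subG]] monom_polys_in[OF subG])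
  moreover have "Q \<noteq> 0"
  proof -
    have "poly (P n) y \<noteq> 0" using P(2)[of n] g(2) by (simp add: n_def)
    then obtain j where j: "j \<le> M" "poly.coeff (P n) j \<noteq> 0" unfolding evalP[OF order_refl]
      by (metis (no_types, lifting) atMost_iff mult_zero_left sum.neutral)
    then have "H j \<noteq> 0" using coeffH[of n j] by auto
    then have "poly (H j) x \<noteq> 0" using nx H by (auto simp: alg_over_def)
    then show ?thesis using coeffQ[OF j(1)] by auto
  qed
  moreover have "poly Q y = 0"
  proof -
    have "poly Q y = (\<Sum>j\<le>M. \<Sum>k\<le>n. poly.coeff (P k) j * x ^ k * y ^ j)"
      by (simp add: Q_def poly_sum poly_monom evalH sum_distrib_right)
    also have "\<dots> = (\<Sum>k\<le>n. \<Sum>j\<le>M. poly.coeff (P k) j * x ^ k * y ^ j)"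
      by (rule sum.swap)
    also have "\<dots> = (\<Sum>k\<le>n. poly (P k) y * x ^ k)"
      by (intro sum.cong) (auto simp: evalP sum_distrib_left mult_ac)
    also have "\<dots> = poly g x" unfolding P(2) n_def poly_altdef[of g] ..
    finally show ?thesis using g(3) by simp
  qed
  ultimately show ?thesis by (auto simp: alg_over_def)
qed

lemma unital_hom_field_embedding: "field_embedding \<iota> \<Longrightarrow> unital_hom \<iota>"
  by unfold_locales (auto simp: field_embedding_def ring_hom_def)

lemma subfield_adjoin: "subfield_set (adjoin \<iota> S)"
  unfolding adjoin_def by (rule generate_field_subfield)

lemma adjoin_superset: "range \<iota> \<subseteq> adjoin \<iota> S" "S \<subseteq> adjoin \<iota> S"
  unfolding adjoin_def using generate_field_superset[of "range \<iota> \<union> S"] by auto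

lemma adjoin_minimal: "subfield_set F \<Longrightarrow> range \<iota> \<subseteq> F \<Longrightarrow> S \<subseteq> F \<Longrightarrow> adjoin \<iota> S \<subseteq> F"
  unfolding adjoin_def by (rule generate_field_minimal) auto

lemma adjoin_mono: "S \<subseteq> T \<Longrightarrow> adjoin \<iota> S \<subseteq> adjoin \<iota> T"
  using adjoin_minimal[OF subfield_adjoin adjoin_superset(1)] adjoin_superset(2) by blast

lemma adjoin_insert: "generate_field ring_of_type_algebra (adjoin \<iota> S \<union> {c}) = adjoin \<iota> (insert c S)"
proof
  show "generate_field ring_of_type_algebra (adjoin \<iota> S \<union> {c}) \<subseteq> adjoin \<iota> (insert c S)"
    using adjoin_mono[of S "insert c S" \<iota>] adjoin_superset(2)[of "insert c S" \<iota>]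
    by (intro generate_field_minimal subfield_adjoin) auto
  have "adjoin \<iota> S \<union> {c} \<subseteq> generate_field ring_of_type_algebra (adjoin \<iota> S \<union> {c})"
    by (rule generate_field_superset)
  then show "adjoin \<iota> (insert c S) \<subseteq> generate_field ring_of_type_algebra (adjoin \<iota> S \<union> {c})"
    using adjoin_superset(1)[of \<iota> S] adjoin_superset(2)[of S \<iota>]
    by (intro adjoin_minimal generate_field_subfield) auto
qed

text \<open>
  This makes coefficients in the field $K(x_v : v \in V)$ accessible: after clearing denominators
  they lie in the ring $K[x_v : v \in V]$ and are values of polynomials.
\<close>

lemma adjoin_eq_fractions:
  assumes "unital_hom \<iota>"
  shows "adjoin \<iota> (x ` V) = fractions (eval_ring \<iota> x V)"
proof
  interpret unital_hom \<iota> by fact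
  have A: "subring_set (eval_ring \<iota> x V)" by (rule subring_eval_ring[OF assms])
  have "range \<iota> \<subseteq> eval_ring \<iota> x V" "x ` V \<subseteq> eval_ring \<iota> x V"
    using eval_ring_const[OF assms] eval_ring_var[OF assms] by auto
  then show "adjoin \<iota> (x ` V) \<subseteq> fractions (eval_ring \<iota> x V)"
    using subset_fractions[OF A] by (meson adjoin_minimal order_trans subfield_fractions[OF A])
  note sub = subring_set_closed[OF subfield_set_subring[OF subfield_adjoin[of \<iota> "x ` V"]]]
  have "mpoly_subst \<iota> x p \<in> adjoin \<iota> (x ` V)" if "p \<in> mpolys_in V" for p
    using that adjoin_superset(1)[of \<iota> "x ` V"] adjoin_superset(2)[of "x ` V" \<iota>]
    by (induction rule: mpolys_in_induct)
      (auto simp: mpoly_subst_mconst mpoly_subst_mvar mpoly_subst_add mpoly_subst_mult intro: sub)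
  then show "fractions (eval_ring \<iota> x V) \<subseteq> adjoin \<iota> (x ` V)"
    by (intro fractions_minimal[OF subfield_adjoin]) (auto simp: eval_ring_def[OF assms])
qed

lemma alg_over_adjoin_iff:
  assumes "unital_hom \<iota>"
  shows "alg_over (adjoin \<iota> (x ` V)) y \<longleftrightarrow> alg_over (eval_ring \<iota> x V) y"
  unfolding adjoin_eq_fractions[OF assms] by (rule alg_over_fractions_iff[OF subring_eval_ring[OF assms]])

lemma indep_on_not_alg_over:
  assumes h: "unital_hom \<iota>" and V: "indep_on \<iota> x V" and v: "v \<in> V"
  shows "\<not> alg_over (adjoin \<iota> (x ` (V - {v}))) (x v)"
proof
  assume "alg_over (adjoin \<iota> (x ` (V - {v}))) (x v)"
  then have "alg_over (eval_ring \<iota> x (V - {v})) (x v)" by (simp only: alg_over_adjoin_iff[OF h])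
  then obtain f where f: "f \<in> polys_in (eval_ring \<iota> x (V - {v}))" "f \<noteq> 0" "poly f (x v) = 0"
    unfolding alg_over_def by blast
  have ins: "insert v (V - {v}) = V" using v by blast
  obtain p where p: "p \<in> mpolys_in V" "f = subst_all_but \<iota> x v p"
    using f(1) subst_all_but_image[OF h, of v "V - {v}" x] unfolding ins by blast
  have "mpoly_subst \<iota> x p = 0" using f(3) unfolding p(2) poly_subst_all_but[OF h] .
  then have "p = 0" using V p(1) unfolding indep_on_def[OF h] by blast
  then show False using f(2) p(2) by (simp add: unital_hom.hom_zero[OF unital_hom_subst_all_but[OF h]])
qed

text \<open>
  Add the elements one at a time. If \<open>V\<close> is still independent but
  \<open>insert v V\<close> is not, a nontrivial relation stays nonzero when all variables but
  \<open>v\<close> are substituted, so it shows that \<open>x v\<close> is algebraic over the field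
  generated by the rest.
\<close>

lemma not_indep_on_alg_over:
  assumes h: "unital_hom \<iota>" and "finite V" "\<not> indep_on \<iota> x V"
  shows "\<exists>v\<in>V. alg_over (adjoin \<iota> (x ` (V - {v}))) (x v)"
  using assms(2,3)
proof (induction V)
  case empty
  interpret unital_hom \<iota> by fact
  have "p = 0" if "p \<in> mpolys_in {}" "mpoly_subst \<iota> x p = 0" for p
  proof -
    have "\<exists>c. p = mconst c" using that(1)
    proof (induction rule: mpolys_in_induct)
      case (add p q)
      then obtain c d where "p = mconst c" "q = mconst d" by blast
      then have "p + q = mconst (c + d)" by (simp add: mconst_def Poly_Mapping.single_add)
      then show ?case ..
    next
      case (mult p q)
      then obtain c d where "p = mconst c" "q = mconst d" by blast
      then have "p * q = mconst (c * d)" by (simp add: mconst_def mult_single)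
      then show ?case ..
    qed auto
    then obtain c where c: "p = mconst c" by blast
    then have "\<iota> c = 0" using that(2) by (simp add: mpoly_subst_mconst)
    then have "c = 0" using hom_mult[of c "inverse c"] hom_one by (cases "c = 0") auto
    then show ?thesis using c by (simp add: mconst_def)
  qed
  then show ?case using empty by (auto simp: indep_on_def[OF h])
next
  case (insert v V)
  show ?case
  proof (cases "indep_on \<iota> x V")
    case True
    obtain p where p: "p \<in> mpolys_in (insert v V)" "mpoly_subst \<iota> x p = 0" "p \<noteq> 0"
      using insert.prems by (auto simp: indep_on_def[OF h])
    let ?f = "subst_all_but \<iota> x v p"
    have "?f \<in> polys_in (eval_ring \<iota> x V)" using subst_all_but_image[OF h insert.hyps(2)] p(1) by blast
    moreover have "?f \<noteq> 0" using subst_all_but_eq_0_iff[OF h True p(1)] p(3) by simp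
    moreover have "poly ?f (x v) = 0" by (simp add: poly_subst_all_but[OF h] p(2))
    ultimately have "alg_over (eval_ring \<iota> x V) (x v)" unfolding alg_over_def by blast
    then show ?thesis using insert.hyps(2) by (simp add: alg_over_adjoin_iff[OF h])
  next
    case False
    then obtain w where w: "w \<in> V" "alg_over (adjoin \<iota> (x ` (V - {w}))) (x w)" using insert.IH by blast
    then have "alg_over (adjoin \<iota> (x ` (insert v V - {w}))) (x w)"
      by (intro alg_over_mono[OF adjoin_mono w(2)]) blast
    then show ?thesis using w(1) by blast
  qed
qed

text \<open>
  Adding the elements of \<open>D\<close> to \<open>S\<close> one at a time, there is a step at
  which \<open>P\<close> becomes true.
\<close>

lemma chain_crossing:
  assumes "finite D" "\<not> P S" "P (S \<union> D)"
  shows "\<exists>C c. c \<in> D \<and> C \<subseteq> D - {c} \<and> \<not> P (S \<union> C) \<and> P (insert c (S \<union> C))"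
  using assms
proof (induction D)
  case (insert d D)
  show ?case
  proof (cases "P (S \<union> D)")
    case True
    then show ?thesis using insert.IH insert.prems insert.hyps by blast
  next
    case False
    then have "d \<in> insert d D \<and> D \<subseteq> insert d D - {d} \<and> \<not> P (S \<union> D) \<and> P (insert d (S \<union> D))"
      using insert by simp
    then show ?thesis by blast
  qed
qed simp

lemma alg_over_exchange_adjoin:
  assumes "alg_over (adjoin \<iota> (insert y S)) x" "\<not> alg_over (adjoin \<iota> S) x"
  shows "alg_over (adjoin \<iota> (insert x S)) y"
  using alg_over_exchange[OF subfield_adjoin, of \<iota> S y x] assms unfolding adjoin_insert by blast

lemma alg_over_trans_adjoin:
  assumes "alg_over (adjoin \<iota> S) c" "alg_over (adjoin \<iota> (insert c S)) x"
  shows "alg_over (adjoin \<iota> S) x"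
  using alg_over_trans[OF subfield_adjoin, of \<iota> S c x] assms unfolding adjoin_insert by blast

text \<open>
  The exchange argument: an element \<open>b\<close> of \<open>B\<close> outside \<open>A\<close>
  can replace some \<open>c\<close> in \<open>A - B\<close> such that everything algebraic over
  \<open>K(A)\<close> stays algebraic over the new field. Iterating, \<open>A\<close> comes to
  contain \<open>B\<close> while its size does not grow.
\<close>

theorem algebraic_steinitz:
  assumes "finite A" "finite B" "\<And>b. b \<in> B \<Longrightarrow> \<not> alg_over (adjoin \<iota> (B - {b})) b"
    and "\<And>b. b \<in> B \<Longrightarrow> alg_over (adjoin \<iota> A) b"
  shows "card B \<le> card A"
  using assms(1,4)
proof (induction "card (B - A)" arbitrary: A rule: less_induct)
  case less
  show ?case
  proof (cases "B \<subseteq> A")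
    case True
    then show ?thesis using less.prems(1) by (rule card_mono[rotated])
  next
    case False
    then obtain b where b: "b \<in> B" "b \<notin> A" by blast
    have "\<not> alg_over (adjoin \<iota> (A \<inter> B)) b"
      using assms(3)[OF b(1)] alg_over_mono[OF adjoin_mono[of "A \<inter> B" "B - {b}" \<iota>], of b] b by blast
    moreover have "alg_over (adjoin \<iota> (A \<inter> B \<union> (A - B))) b"
      using less.prems(2)[OF b(1)] by (simp add: Int_Diff_Un)
    ultimately obtain C c where C: "c \<in> A - B" "C \<subseteq> A - B - {c}" "\<not> alg_over (adjoin \<iota> (A \<inter> B \<union> C)) b"
      "alg_over (adjoin \<iota> (insert c (A \<inter> B \<union> C))) b"
      using chain_crossing[of "A - B" "\<lambda>S. alg_over (adjoin \<iota> S) b" "A \<inter> B"] less.prems(1) by blast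
    let ?A = "insert b (A - {c})"
    have "alg_over (adjoin \<iota> (insert b (A \<inter> B \<union> C))) c" using alg_over_exchange_adjoin C by blast
    then have c: "alg_over (adjoin \<iota> ?A) c"
      by (rule alg_over_mono[OF adjoin_mono, rotated]) (use C in blast)
    have "alg_over (adjoin \<iota> ?A) x" if "x \<in> B" for x
    proof (rule alg_over_trans_adjoin[OF c])
      show "alg_over (adjoin \<iota> (insert c ?A)) x"
        by (rule alg_over_mono[OF adjoin_mono less.prems(2)[OF that]]) blast
    qed
    moreover have "card (B - ?A) < card (B - A)"
      using b C assms(2) by (intro psubset_card_mono) auto
    ultimately have "card B \<le> card ?A" using less.hyps[of ?A] less.prems(1) by blast
    also have "card ?A \<le> card A"
      using less.prems(1) b C card_Suc_Diff1[of A c] by simp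
    finally show ?thesis .
  qed
qed

lemma alg_independent_iff: "unital_hom \<iota> \<Longrightarrow> alg_independent \<iota> B \<longleftrightarrow> indep_on \<iota> (\<lambda>b. b) B"
  by (auto simp: alg_independent_def indep_on_def mpolys_in_def)

text \<open>
  If the \<open>x v\<close> were dependent, one of them would be algebraic over the field generated
  by the other ones, and so would the whole field. A transcendence basis of size
  \<open>card V\<close> would then have more elements than this generating set, against the exchange
  argument.
\<close>

lemma indep_on_of_trdeg:
  assumes h: "unital_hom \<iota>" and V: "finite V" and tr: "has_trdeg \<iota> (adjoin \<iota> (x ` V)) (card V)"
  shows "indep_on \<iota> x V"
proof (rule ccontr)
  assume "\<not> indep_on \<iota> x V"
  then obtain v where v: "v \<in> V" "alg_over (adjoin \<iota> (x ` (V - {v}))) (x v)"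
    using not_indep_on_alg_over[OF h V] by blast
  obtain B where B: "B \<subseteq> adjoin \<iota> (x ` V)" "alg_independent \<iota> B" "finite B" "card B = card V"
    using tr by (auto simp: has_trdeg_def transcendence_basis_def)
  have "card B \<le> card (x ` (V - {v}))"
  proof (rule algebraic_steinitz[of _ _ \<iota>])
    show "\<not> alg_over (adjoin \<iota> (B - {b})) b" if "b \<in> B" for b
      using indep_on_not_alg_over[OF h, of "\<lambda>b. b" B b] B(2) that by (simp add: alg_independent_iff[OF h])
    show "alg_over (adjoin \<iota> (x ` (V - {v}))) b" if "b \<in> B" for b
    proof (rule alg_over_trans_adjoin[OF v(2)])
      have "insert (x v) (x ` (V - {v})) = x ` V" using v(1) by blast
      then show "alg_over (adjoin \<iota> (insert (x v) (x ` (V - {v})))) b"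
        using that B(1) by (simp add: alg_over_self[OF subfield_set_subring[OF subfield_adjoin]] subset_eq)
    qed
  qed (use V B in auto)
  also have "\<dots> \<le> card (V - {v})" using V by (intro card_image_le) auto
  also have "\<dots> < card V" using V v(1) by (intro card_Diff1_less)
  finally show False using B(4) by simp
qed

section \<open>The polynomial of an algebraic circuit\<close>

lemma divides_in_range_iff:
  assumes \<phi>: "unital_hom \<phi>" and inj: "inj \<phi>"
  shows "divides_in (range \<phi>) (\<phi> p) (\<phi> q) \<longleftrightarrow> p dvd q"
  using injD[OF inj] by (auto simp: divides_in_def dvd_def unital_hom.hom_mult[OF \<phi>, symmetric])

text \<open>
  The polynomial ring itself is identified with its image in the univariate polynomials over the
  extension field; irreducibility there is meant relative to the image.
\<close>

lemma irreducible_in_range_iff: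
  assumes \<phi>: "unital_hom \<phi>" and inj: "inj \<phi>"
  shows "irreducible_in (range \<phi>) (\<phi> p) \<longleftrightarrow> Factorial_Ring.irreducible p"
proof -
  interpret unital_hom \<phi> by fact
  have "divides_in (range \<phi>) (\<phi> a) 1 \<longleftrightarrow> a dvd 1" for a
    using divides_in_range_iff[OF assms, of a 1] by (simp add: hom_one)
  moreover have "\<phi> p = 0 \<longleftrightarrow> p = 0" using inj_eq[OF inj, of p 0] by (simp add: hom_zero)
  moreover have "\<phi> p = \<phi> a * \<phi> b \<longleftrightarrow> p = a * b" for a b
    using inj_eq[OF inj, of p "a * b"] by (simp add: hom_mult)
  ultimately show ?thesis by (auto simp: irreducible_in_def Factorial_Ring.irreducible_def)
qed

text \<open>
  What is used of an algebraic circuit: any \<open>n - 1\<close> of the elements are independent,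
  and the remaining one is algebraic over the field that they generate.
\<close>

locale circuit =
  fixes \<iota> :: "'k::field \<Rightarrow> 'e::field" and \<alpha> :: "'n::finite \<Rightarrow> 'e"
  assumes hom: "unital_hom \<iota>"
    and indep: "indep_on \<iota> \<alpha> (UNIV - {i})"
    and alg: "alg_over (adjoin \<iota> (\<alpha> ` (UNIV - {i}))) (\<alpha> i)"
begin

abbreviation A :: "'n \<Rightarrow> 'e set" where
  "A i \<equiv> eval_ring \<iota> \<alpha> (UNIV - {i})"

abbreviation L :: "'n \<Rightarrow> 'e set" where
  "L i \<equiv> adjoin \<iota> (\<alpha> ` (UNIV - {i}))"

abbreviation \<Phi> :: "'n \<Rightarrow> ('n, 'k) mpoly \<Rightarrow> 'e poly" where
  "\<Phi> i \<equiv> subst_all_but \<iota> \<alpha> i"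

lemma insert_UNIV_Diff: "insert i (UNIV - {i}) = (UNIV :: 'n set)"
  by auto

lemma L_eq: "L i = fractions (A i)"
  by (rule adjoin_eq_fractions[OF hom])

lemma subring_A: "subring_set (A i)"
  by (rule subring_eval_ring[OF hom])

lemma hom_\<Phi>: "unital_hom (\<Phi> i)"
  by (rule unital_hom_subst_all_but[OF hom])

lemma range_\<Phi>: "range (\<Phi> i) = polys_in (A i)"
  using subst_all_but_image[OF hom, of i "UNIV - {i}" \<alpha>] by (simp add: insert_UNIV_Diff mpolys_in_UNIV)

lemma inj_\<Phi>: "inj (\<Phi> i)"
  using inj_subst_all_but[OF hom indep, of i i] by (simp add: insert_UNIV_Diff mpolys_in_UNIV)

lemma degree_\<Phi>: "Polynomial.degree (\<Phi> i p) = deg_in i p"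
  using degree_subst_all_but[OF hom indep, of p i i] by (simp add: insert_UNIV_Diff mpolys_in_UNIV)

lemma poly_\<Phi>: "poly (\<Phi> i p) (\<alpha> i) = mpoly_subst \<iota> \<alpha> p"
  by (rule poly_subst_all_but[OF hom])

lemma \<Phi>_eq_0_iff: "\<Phi> i p = 0 \<longleftrightarrow> p = 0"
  using inj_eq[OF inj_\<Phi>, of i p 0] by (simp add: unital_hom.hom_zero[OF hom_\<Phi>])

text \<open>
  The image of the vanishing ideal under \<open>\<Phi> i\<close> is the ideal of all elements of
  \<open>(A i)[X]\<close> with the root \<open>\<alpha> i\<close>. It contains no nonzero constant,
  and \<open>A i\<close> is factorial, so the irreducible \<open>\<theta>\<close> generates it.
\<close>

lemma irreducible_dvd_vanishing:
  assumes \<theta>: "Factorial_Ring.irreducible \<theta>" "mpoly_subst \<iota> \<alpha> \<theta> = 0"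
    and f: "mpoly_subst \<iota> \<alpha> f = 0"
  shows "\<theta> dvd f"
proof -
  define i :: 'n where "i = undefined"
  let ?I = "{g \<in> polys_in (A i). poly g (\<alpha> i) = 0}"
  note cl = subring_set_closed[OF subring_polys_in[OF subring_A[of i]]]
  have fact: "factorial_in (A i)" by (rule factorial_in_eval_ring[OF hom _ indep]) simp
  have "divides_in (polys_in (A i)) (\<Phi> i \<theta>) (\<Phi> i f)"
  proof (rule irreducible_generates_ideal[OF fact, of ?I])
    show "irreducible_in (polys_in (A i)) (\<Phi> i \<theta>)"
      using irreducible_in_range_iff[OF hom_\<Phi> inj_\<Phi>, of i \<theta>] \<theta>(1) by (simp only: range_\<Phi>)
    show "\<Phi> i \<theta> \<in> ?I" "\<Phi> i f \<in> ?I" using \<theta>(2) f by (auto simp: poly_\<Phi> range_\<Phi>[symmetric])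
  qed (auto intro: cl)
  then show ?thesis using divides_in_range_iff[OF hom_\<Phi> inj_\<Phi>, of i \<theta> f] by (simp only: range_\<Phi>)
qed

text \<open>
  An equation of \<open>\<alpha> i\<close> over \<open>L i\<close> gives, after clearing
  denominators, a nonzero element of \<open>(A i)[X]\<close> with the root
  \<open>\<alpha> i\<close>. An element of least length of this prime ideal is irreducible.
\<close>

lemma exists_irreducible_vanishing:
  "\<exists>\<theta>. Factorial_Ring.irreducible \<theta> \<and> mpoly_subst \<iota> \<alpha> \<theta> = 0"
proof -
  define i :: 'n where "i = undefined"
  have "factorial_in (polys_in (A i))"
    by (rule factorial_in_polys_in, rule factorial_in_eval_ring[OF hom _ indep]) simp
  then obtain \<rho> where \<rho>: "length_on (polys_in (A i)) \<rho>" by (auto simp: factorial_in_def)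
  have "alg_over (A i) (\<alpha> i)"
    using alg[of i] alg_over_fractions_iff[OF subring_A, of i "\<alpha> i"] by (simp only: L_eq)
  then obtain f where f: "f \<in> polys_in (A i)" "f \<noteq> 0" "poly f (\<alpha> i) = 0"
    unfolding alg_over_def by blast
  have "\<exists>p\<in>{p. poly p (\<alpha> i) = 0}. irreducible_in (polys_in (A i)) p"
    by (rule irreducible_in_exists[OF \<rho>, of _ f]) (use f in auto)
  then obtain p where p: "poly p (\<alpha> i) = 0" "irreducible_in (polys_in (A i)) p" by blast
  then have "p \<in> range (\<Phi> i)" by (simp add: range_\<Phi> irreducible_in_def)
  then obtain \<theta> where \<theta>: "p = \<Phi> i \<theta>" by blast
  have "Factorial_Ring.irreducible \<theta>"
    using irreducible_in_range_iff[OF hom_\<Phi> inj_\<Phi>, of i \<theta>] p(2) \<theta> by (simp only: range_\<Phi>)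
  moreover have "mpoly_subst \<iota> \<alpha> \<theta> = 0" using p(1) \<theta> by (simp add: poly_\<Phi>)
  ultimately show ?thesis by blast
qed

lemma deg_in_le_of_dvd:
  fixes p q :: "('n, 'k) mpoly"
  assumes "p dvd q" "q \<noteq> 0"
  shows "deg_in i p \<le> deg_in i q"
proof -
  obtain r where r: "q = p * r" using assms(1) by blast
  then have "\<Phi> i q = \<Phi> i p * \<Phi> i r" by (simp add: unital_hom.hom_mult[OF hom_\<Phi>])
  moreover have "\<Phi> i q \<noteq> 0" using assms(2) by (simp add: \<Phi>_eq_0_iff)
  ultimately show ?thesis unfolding degree_\<Phi>[symmetric] by (metis dvd_triv_left dvd_imp_degree_le)
qed

lemma generate_L: "generate_field ring_of_type_algebra (L i \<union> {\<alpha> i}) = adjoin \<iota> (\<alpha> ` UNIV)"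
proof -
  have "insert (\<alpha> i) (\<alpha> ` (UNIV - {i})) = \<alpha> ` UNIV" by auto
  then show ?thesis by (simp only: adjoin_insert)
qed

lemma \<Phi>_polys_in_L: "\<Phi> i p \<in> polys_in (L i)"
proof -
  have "\<Phi> i p \<in> polys_in (A i)" by (simp add: range_\<Phi>[symmetric])
  then show ?thesis using subset_fractions[OF subring_A[of i]] by (auto simp: polys_in_def L_eq)
qed

text \<open>
  Any \<open>g\<close> over \<open>L i\<close> with the root \<open>\<alpha> i\<close> is, up to a
  nonzero factor, the image of a multiple of \<open>\<theta>\<close>. So
  \<open>\<Phi> i \<theta>\<close> has the degree of the minimal polynomial of
  \<open>\<alpha> i\<close>.
\<close>

lemma ext_degree_eq_deg_in:
  assumes \<theta>: "Factorial_Ring.irreducible \<theta>" "mpoly_subst \<iota> \<alpha> \<theta> = 0"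
  shows "ext_degree (L i) (adjoin \<iota> (\<alpha> ` UNIV)) (deg_in i \<theta>)"
  unfolding generate_L[of i, symmetric] degree_\<Phi>[symmetric]
proof (rule ext_degree_simple[OF subfield_adjoin \<Phi>_polys_in_L])
  show "\<Phi> i \<theta> \<noteq> 0" using \<theta>(1) by (auto simp: \<Phi>_eq_0_iff)
  show "poly (\<Phi> i \<theta>) (\<alpha> i) = 0" by (simp add: poly_\<Phi> \<theta>(2))
  fix g assume g: "g \<in> polys_in (L i)" "g \<noteq> 0" "poly g (\<alpha> i) = 0"
  obtain d where d: "d \<noteq> 0" "Polynomial.smult d g \<in> polys_in (A i)"
    using clear_denominators[OF subring_A] g(1) unfolding L_eq by blast
  then obtain f where f: "Polynomial.smult d g = \<Phi> i f" unfolding range_\<Phi>[symmetric] by blast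
  have "mpoly_subst \<iota> \<alpha> f = 0" using g(3) by (simp add: poly_\<Phi>[of i, symmetric] f[symmetric])
  then have "\<theta> dvd f" by (rule irreducible_dvd_vanishing[OF \<theta>])
  moreover have "f \<noteq> 0" using d(1) g(2) f \<Phi>_eq_0_iff[of i f] by auto
  ultimately have "deg_in i \<theta> \<le> deg_in i f" by (rule deg_in_le_of_dvd)
  then show "Polynomial.degree (\<Phi> i \<theta>) \<le> Polynomial.degree g"
    using d(1) by (simp add: degree_\<Phi>[symmetric] f[symmetric])
qed

text \<open>
  Irreducibility and vanishing determine the degrees, and both are conditions without reference to
  \<open>i\<close>, so a polynomial found with one choice of \<open>i\<close> has the right degree
  in every variable.
\<close>

lemma circuit_poly_iff:
  "circuit_poly \<iota> \<alpha> \<theta> \<longleftrightarrow> Factorial_Ring.irreducible \<theta> \<and> mpoly_subst \<iota> \<alpha> \<theta> = 0"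
  using ext_degree_eq_deg_in by (auto simp: circuit_poly_def)

text \<open>
  A unit has degree zero in each variable, as its image under each \<open>\<Phi> i\<close> is a unit
  of a polynomial ring over a field.
\<close>

lemma unit_is_const:
  assumes "u dvd 1"
  shows "\<exists>c. c \<noteq> 0 \<and> u = (mconst c :: ('n, 'k) mpoly)"
proof -
  obtain w where w: "1 = u * w" using assms by blast
  have "deg_in i u = 0" for i
  proof -
    have "1 = \<Phi> i u * \<Phi> i w"
      using w by (metis unital_hom.hom_mult[OF hom_\<Phi>] unital_hom.hom_one[OF hom_\<Phi>])
    then have "\<Phi> i u dvd 1" by (rule dvdI)
    then show ?thesis unfolding degree_\<Phi>[symmetric] using dvd_imp_degree_le[of "\<Phi> i u" 1] by simp
  qed
  then have "Poly_Mapping.lookup m i = 0" if "m \<in> Poly_Mapping.keys u" for m i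
    using that Max_ge[of "insert 0 ((\<lambda>m. Poly_Mapping.lookup m i) ` Poly_Mapping.keys u)" "Poly_Mapping.lookup m i"]
    by (simp add: deg_in_def)
  then have "m = 0" if "m \<in> Poly_Mapping.keys u" for m using that by (intro poly_mapping_eqI) simp
  then have u: "u = mconst (Poly_Mapping.lookup u 0)"
    unfolding mconst_def by (intro poly_mapping_eqI) (auto simp: lookup_single when_def in_keys_iff)
  moreover have "u \<noteq> 0" using w by auto
  ultimately show ?thesis by (metis mconst_def Poly_Mapping.single_zero)
qed

end

lemma circuitI:
  fixes \<iota> :: "'k::field \<Rightarrow> 'e::field" and \<alpha> :: "'n::finite \<Rightarrow> 'e"
  assumes "field_embedding \<iota>" "algebraic_circuit \<iota> \<alpha>"
  shows "circuit \<iota> \<alpha>"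
proof (rule circuit.intro)
  show h: "unital_hom \<iota>" by (rule unital_hom_field_embedding[OF assms(1)])
  fix i :: 'n
  let ?V = "UNIV - {i}"
  have "card ?V = card (UNIV :: 'n set) - 1" by (simp add: card_Diff_singleton)
  then have "has_trdeg \<iota> (adjoin \<iota> (\<alpha> ` ?V)) (card ?V)"
    using assms(2) by (simp add: algebraic_circuit_def)
  then show "indep_on \<iota> \<alpha> ?V" by (intro indep_on_of_trdeg[OF h]) simp_all
  have "\<alpha> i \<in> adjoin \<iota> (\<alpha> ` UNIV)" using adjoin_superset(2)[of "\<alpha> ` UNIV" \<iota>] by blast
  then show "alg_over (adjoin \<iota> (\<alpha> ` ?V)) (\<alpha> i)"
    using assms(2) unfolding algebraic_circuit_def algebraic_ext_def
    by (simp add: algebraic_iff_alg_over[OF subfield_adjoin])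
qed

theorem theorem5p4:
  fixes \<iota> :: "'k::field \<Rightarrow> 'e::field" and \<alpha> :: "'n::finite \<Rightarrow> 'e"
  assumes "field_embedding \<iota>" and "algebraic_circuit \<iota> \<alpha>"
  shows
    "(\<exists>\<theta>. circuit_poly \<iota> \<alpha> \<theta>) \<and>
     (\<forall>\<theta> \<theta>'. circuit_poly \<iota> \<alpha> \<theta> \<longrightarrow> circuit_poly \<iota> \<alpha> \<theta>' \<longrightarrow>
        (\<exists>c. c \<noteq> 0 \<and> \<theta>' = mconst c * \<theta>)) \<and>
     (\<forall>\<theta>. circuit_poly \<iota> \<alpha> \<theta> \<longrightarrow>
        (\<forall>f. f \<noteq> 0 \<longrightarrow> mpoly_subst \<iota> \<alpha> f = 0 \<longrightarrow>
           (\<forall>i. deg_in i f \<ge> deg_in i \<theta>) \<and> \<theta> dvd f)) \<and>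
     (\<forall>\<theta>. circuit_poly \<iota> \<alpha> \<theta> \<longrightarrow>
        (\<forall>i. infimal_poly (adjoin \<iota> (\<alpha> ` (UNIV - {i}))) (\<alpha> i) (subst_all_but \<iota> \<alpha> i \<theta>)))"
proof -
  interpret circuit \<iota> \<alpha> by (rule circuitI[OF assms])
  show ?thesis
  proof (intro conjI allI impI)
    show "\<exists>\<theta>. circuit_poly \<iota> \<alpha> \<theta>" using exists_irreducible_vanishing by (simp add: circuit_poly_iff)
  next
    fix \<theta> \<theta>' assume \<theta>: "circuit_poly \<iota> \<alpha> \<theta>" "circuit_poly \<iota> \<alpha> \<theta>'"
    then have "\<theta> dvd \<theta>'" unfolding circuit_poly_iff using irreducible_dvd_vanishing by blast
    then obtain u where u: "\<theta>' = \<theta> * u" by blast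
    have "u dvd 1" using \<theta> u unfolding circuit_poly_iff Factorial_Ring.irreducible_def by blast
    then show "\<exists>c. c \<noteq> 0 \<and> \<theta>' = mconst c * \<theta>" using unit_is_const u by (metis mult.commute)
  next
    fix \<theta> f assume \<theta>: "circuit_poly \<iota> \<alpha> \<theta>" and f: "f \<noteq> 0" "mpoly_subst \<iota> \<alpha> f = 0"
    show d: "\<theta> dvd f" using \<theta> f(2) unfolding circuit_poly_iff using irreducible_dvd_vanishing by blast
    show "deg_in i \<theta> \<le> deg_in i f" for i by (rule deg_in_le_of_dvd[OF d f(1)])
  next
    fix \<theta> i assume \<theta>: "circuit_poly \<iota> \<alpha> \<theta>"
    have "\<forall>k. poly.coeff (\<Phi> i \<theta>) k \<in> L i" using \<Phi>_polys_in_L by (simp add: polys_in_def)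
    moreover have "poly (\<Phi> i \<theta>) (\<alpha> i) = 0" using \<theta> by (simp add: poly_\<Phi> circuit_poly_iff)
    ultimately show "infimal_poly (L i) (\<alpha> i) (\<Phi> i \<theta>)"
      unfolding infimal_poly_def generate_L degree_\<Phi> using \<theta> by (simp add: circuit_poly_def)
  qed
qed

end
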